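(* Let $f\colon\mathbb R\to\mathbb R$ be $1$-periodic, in $L^2(\mathbb T)$, of zero mean, with absolutely summable Fourier coefficients $\widehat f(n)$. For $m\ge1$ let $f_m(x)=\sum_{j=0}^{m-1}f(x+j/m)=m\sum_{l\in\mathbb Z}\widehat f(lm)e^{2\pi i lmx}$. Suppose there exist a sequence $(q_n)\subset\mathbb N$ and a constant $C>0$ such that $q_n\sum_{l\in\mathbb Z}|\widehat f(lq_n)|\le C\|f_{q_n}\|_{L^2}$ for all $n\ge1$ and $0<\|f_{q_n}\|_{L^2}\to0$. Then there is a dense $G_\delta$ set of irrational numbers $\alpha$ such that, for $Tx=x+\alpha$, the group extensions $T_{f^{(r)}(r\cdot)}(x,t)=(x+\alpha,f^{(r)}(rx)+t)$ of $(\mathbb T\times\mathbb R,\lambda_{\mathbb T}\otimes\lambda_{\mathbb R})$ are ergodic for all $r\ge1$.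
   Context: $f^{(r)}(x)=\sum_{j=0}^{r-1}f(x+j\alpha)$. *)

theory Defs
  imports "HOL-Analysis.Analysis"
begin

text \<open>The circle T = R/Z is represented by the fundamental domain [0,1) with
  Lebesgue measure; 1-periodic functions on R are functions on T.\<close>

definition fourier_coeff :: "(real \<Rightarrow> real) \<Rightarrow> int \<Rightarrow> complex" where
  "fourier_coeff f n =
     integral\<^sup>L (lebesgue_on {0..1}) (\<lambda>x. complex_of_real (f x) * cis (- 2 * pi * real_of_int n * x))"

definition L2_norm_T :: "(real \<Rightarrow> real) \<Rightarrow> real" where
  "L2_norm_T f = sqrt (integral\<^sup>L (lebesgue_on {0..1}) (\<lambda>x. (f x)\<^sup>2))"

definition fold_sum :: "(real \<Rightarrow> real) \<Rightarrow> nat \<Rightarrow> real \<Rightarrow> real" where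
  "fold_sum f m x = (\<Sum>j<m. f (x + real j / real m))"

definition birkhoff_sum :: "(real \<Rightarrow> real) \<Rightarrow> real \<Rightarrow> nat \<Rightarrow> real \<Rightarrow> real" where
  "birkhoff_sum f \<alpha> r x = (\<Sum>j<r. f (x + real j * \<alpha>))"

definition TxR_measure :: "(real \<times> real) measure" where
  "TxR_measure = restrict_space lborel {0..<1} \<Otimes>\<^sub>M lborel"

definition skew_map :: "real \<Rightarrow> (real \<Rightarrow> real) \<Rightarrow> real \<times> real \<Rightarrow> real \<times> real" where
  "skew_map \<alpha> \<phi> p = (frac (fst p + \<alpha>), \<phi> (fst p) + snd p)"

definition ergodic_skew :: "real \<Rightarrow> (real \<Rightarrow> real) \<Rightarrow> bool" where
  "ergodic_skew \<alpha> \<phi> \<longleftrightarrow>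
     (\<forall>A \<in> sets TxR_measure.
        skew_map \<alpha> \<phi> -` A \<inter> space TxR_measure = A \<longrightarrow>
        emeasure TxR_measure A = 0 \<or> emeasure TxR_measure (space TxR_measure - A) = 0)"

end

theory Submission
  imports Defs "HOL-Analysis.Kronecker_Approximation_Theorem" "HOL-Computational_Algebra.Primes"
begin

text \<open>For \<open>\<alpha>\<close> extremely close to \<open>p/q\<close> with \<open>p\<close>, \<open>q\<close> coprime and \<open>q\<close> one of the given denominators, the
  Birkhoff sum of length \<open>h q\<close> of the cocycle \<open>x \<mapsto> f\<^sup>(\<^sup>r\<^sup>)(r x)\<close> is uniformly close to
  \<open>\<psi>(x) = r h f\<^sub>q(r x)\<close>. Choosing \<open>h\<close> so that \<open>\<psi>\<close> has \<open>L\<^sup>2\<close>-norm about \<open>\<sigma>\<close>, the hypothesis on the Fourier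
  coefficients gives \<open>\<bar>\<psi>\<bar> \<le> 2 C \<sigma>\<close>, so \<open>\<bar>\<psi>\<bar> \<ge> \<sigma>/2\<close> on a set of measure bounded below. An invariant set
  \<open>E\<close> is almost unchanged when the point \<open>(x, t)\<close> is moved to \<open>(x, t + \<psi>(x))\<close>, because \<open>h q \<alpha>\<close> is almost an
  integer. As \<open>\<psi>\<close> oscillates rapidly, the values \<open>\<psi>(x)\<close> become independent of \<open>x\<close>; hence for some \<open>s\<close> with
  \<open>\<sigma>/2 \<le> \<bar>s\<bar> \<le> 2 C \<sigma>\<close> the vertical translation by \<open>s\<close> almost preserves \<open>E\<close>, and by compactness one such
  translation preserves \<open>E\<close> up to a null set. Since \<open>\<sigma>\<close> is arbitrary and the periods of \<open>E\<close> form a closed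
  group, all vertical translations preserve \<open>E\<close>, then so does the rotation by \<open>\<alpha>\<close>, and \<open>E\<close> is null or conull.
  The \<open>\<alpha>\<close> that are close enough to such fractions infinitely often form a dense \<open>G\<^sub>\<delta>\<close>, because the
  fractions with large denominator \<open>q\<close> and numerator coprime to \<open>q\<close> are dense.\<close>

lemma periodic_of_int:
  fixes k :: "real \<Rightarrow> 'b" and T :: real
  assumes "\<And>x. k (x + T) = k x"
  shows "k (x + of_int n * T) = k x"
proof (induction n rule: int_induct[where k=0])
  case (step1 i)
  then show ?case using assms[of "x + of_int i * T"] by (simp add: algebra_simps)
next
  case (step2 i)
  then show ?case using assms[of "x + of_int (i - 1) * T"] by (simp add: algebra_simps)
qed simp

section \<open>Shears of the plane\<close>

definition shear :: "real \<Rightarrow> (real \<Rightarrow> real) \<Rightarrow> real \<times> real \<Rightarrow> real \<times> real" where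
  "shear \<beta> e p = (fst p + \<beta>, snd p + e (fst p))"

lemma borel_measurable_shear [measurable]:
  assumes [measurable]: "e \<in> borel_measurable borel"
  shows "shear \<beta> e \<in> borel_measurable borel"
  unfolding shear_def borel_prod[symmetric] by measurable

lemma sets_lborel_pair: "sets (lborel \<Otimes>\<^sub>M lborel) = sets (borel :: (real \<times> real) measure)"
  by (metis lborel_prod sets_lborel)

lemma space_lborel_pair: "space (lborel \<Otimes>\<^sub>M lborel) = (UNIV :: (real \<times> real) set)"
  by (simp add: space_pair_measure)

lemma measurable_section:
  fixes X :: "(real \<times> real) set"
  assumes "X \<in> sets borel"
  shows "{t. (x, t) \<in> X} \<in> sets borel"
proof -
  have "Pair x -` X \<in> sets lborel"
    by (rule sets_Pair1[of _ lborel]) (use assms in \<open>simp only: sets_lborel_pair\<close>)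
  then show ?thesis by (simp add: vimage_def)
qed

lemma emeasure_lborel_sections:
  fixes X :: "(real \<times> real) set"
  assumes "X \<in> sets borel"
  shows "emeasure lborel X = (\<integral>\<^sup>+x. emeasure lborel {t. (x, t) \<in> X} \<partial>lborel)"
proof -
  have "emeasure (lborel \<Otimes>\<^sub>M lborel) X = (\<integral>\<^sup>+x. emeasure lborel (Pair x -` X) \<partial>lborel)"
    by (rule lborel.emeasure_pair_measure_alt) (use assms in \<open>simp only: sets_lborel_pair\<close>)
  then show ?thesis by (simp add: lborel_prod vimage_def)
qed

lemma borel_measurable_section:
  fixes X :: "(real \<times> real) set"
  assumes "X \<in> sets borel"
  shows "(\<lambda>x. emeasure lborel {t. (x, t) \<in> X}) \<in> borel_measurable borel"
proof -
  have "(\<lambda>x. emeasure lborel (Pair x -` X)) \<in> borel_measurable lborel"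
    by (rule lborel.measurable_emeasure_Pair) (use assms in \<open>simp only: sets_lborel_pair\<close>)
  then show ?thesis by (simp add: vimage_def)
qed

lemma emeasure_lborel_translate:
  fixes Y :: "real set"
  assumes [measurable]: "Y \<in> sets borel"
  shows "emeasure lborel {t. t + c \<in> Y} = emeasure lborel Y"
proof -
  have "emeasure lborel Y = (\<integral>\<^sup>+t. indicator Y t \<partial>lborel)" by simp
  also have "\<dots> = (\<integral>\<^sup>+t. indicator Y (c + 1 * t) \<partial>lborel)"
    by (subst nn_integral_real_affine[where c=1 and t=c]) auto
  also have "\<dots> = (\<integral>\<^sup>+t. indicator {t. t + c \<in> Y} t \<partial>lborel)"
    by (intro nn_integral_cong) (auto simp: indicator_def add.commute)
  also have "\<dots> = emeasure lborel {t. t + c \<in> Y}"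
    by (rule nn_integral_indicator) measurable
  finally show ?thesis by simp
qed

lemma emeasure_shear_vimage:
  assumes [measurable]: "e \<in> borel_measurable borel" "X \<in> sets borel"
  shows "emeasure lborel (shear \<beta> e -` X) = emeasure lborel X"
proof -
  have V: "shear \<beta> e -` X \<in> sets borel"
    using measurable_sets_borel[OF borel_measurable_shear assms(2)] assms(1) by simp
  have "emeasure lborel (shear \<beta> e -` X) = (\<integral>\<^sup>+x. emeasure lborel {t. t + e x \<in> {t. (x + \<beta>, t) \<in> X}} \<partial>lborel)"
    using emeasure_lborel_sections[OF V] by (simp add: shear_def)
  also have "\<dots> = (\<integral>\<^sup>+x. emeasure lborel {t. (\<beta> + 1 * x, t) \<in> X} \<partial>lborel)"
    by (subst emeasure_lborel_translate[OF measurable_section[OF assms(2)]]) (simp add: add.commute)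
  also have "\<dots> = (\<integral>\<^sup>+x. emeasure lborel {t. (x, t) \<in> X} \<partial>lborel)"
    using nn_integral_real_affine[where c=1 and t=\<beta>, OF borel_measurable_section[OF assms(2)]] by simp
  also have "\<dots> = emeasure lborel X"
    using emeasure_lborel_sections[OF assms(2)] by simp
  finally show ?thesis .
qed

lemma AE_shear:
  assumes [measurable]: "e \<in> borel_measurable borel" "Measurable.pred borel P"
    and "AE p in lborel. P p"
  shows "AE p in lborel. P (shear \<beta> e p)"
proof -
  have s: "{p. \<not> P p} \<in> sets borel" by measurable
  have "emeasure lborel {p. \<not> P p} = 0"
    using assms(3) by (subst (asm) AE_iff_measurable[OF _ refl]) auto
  then have "emeasure lborel (shear \<beta> e -` {p. \<not> P p}) = 0"
    using emeasure_shear_vimage[OF assms(1) s] by simp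
  then show ?thesis
    by (intro AE_I[where N="shear \<beta> e -` {p. \<not> P p}"])
      (auto intro!: measurable_sets_borel[OF borel_measurable_shear s] assms(1))
qed

lemma AE_lborel_pair_iff:
  fixes P :: "real \<times> real \<Rightarrow> bool"
  assumes "Measurable.pred borel P"
  shows "(AE p in lborel. P p) \<longleftrightarrow> (AE x in lborel. AE t in lborel. P (x, t))"
proof -
  have "{p \<in> space (lborel \<Otimes>\<^sub>M lborel). P (fst p, snd p)} \<in> sets (lborel \<Otimes>\<^sub>M lborel)"
    using assms unfolding sets_lborel_pair space_lborel_pair by (simp add: pred_def)
  from lborel_pair.AE_pair_iff[OF this] show ?thesis unfolding lborel_prod by simp
qed

lemma AE_lborel_fst:
  assumes "AE x in lborel. P x" "Measurable.pred borel P"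
  shows "AE p in (lborel :: (real \<times> real) measure). P (fst p)"
proof -
  have "Measurable.pred borel (\<lambda>p :: real \<times> real. P (fst p))"
    using assms(2) unfolding borel_prod[symmetric] by measurable
  then show ?thesis using assms(1) by (subst AE_lborel_pair_iff) auto
qed

definition disagree :: "('a \<times> 'b) set \<Rightarrow> ('a \<times> 'b) set \<Rightarrow> ('a \<times> 'b \<Rightarrow> 'a \<times> 'b) \<Rightarrow> ('a \<times> 'b) set" where
  "disagree W E S = {p \<in> W. (p \<in> E) \<noteq> (S p \<in> E)}"

lemma disagree_borel [measurable]:
  fixes E W :: "(real \<times> real) set"
  assumes [measurable]: "E \<in> sets borel" "W \<in> sets borel" "S \<in> borel_measurable borel"
  shows "disagree W E S \<in> sets borel"
  unfolding disagree_def by measurable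

text \<open>Sandwich \<open>E\<close> between a compact and an open set. The argument uses only that the displacement is small
  and the map preserves measure, so the vertical displacement may vary with \<open>x\<close>.\<close>

lemma small_shear_disagree:
  fixes E W :: "(real \<times> real) set" and \<epsilon> :: real
  assumes E: "E \<in> sets borel" and W: "bounded W" "W \<in> sets borel" and "\<epsilon> > 0"
  obtains \<delta> where "\<delta> > 0"
    "\<And>\<beta> e. \<bar>\<beta>\<bar> < \<delta> \<Longrightarrow> e \<in> borel_measurable borel \<Longrightarrow> AE x in lborel. \<bar>e x\<bar> < \<delta> \<Longrightarrow>
       emeasure lborel (disagree W E (shear \<beta> e)) \<le> ennreal \<epsilon>"
proof -
  obtain R where R: "\<And>p. p \<in> W \<Longrightarrow> norm p \<le> R"
    using W(1) unfolding bounded_iff by blast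
  define F where "F = E \<inter> cball 0 (R + 1)"
  have Fb: "F \<in> sets borel" using E by (simp add: F_def)
  have Fl: "F \<in> sets lebesgue" using Fb by simp
  have "bounded F" unfolding F_def by auto
  obtain K where K: "closed K" "K \<subseteq> F" "F - K \<in> lmeasurable" "emeasure lebesgue (F - K) < ennreal (\<epsilon>/4)"
    using sets_lebesgue_inner_closed[OF Fl, of "\<epsilon>/4"] \<open>\<epsilon> > 0\<close> by auto
  obtain U where U: "open U" "F \<subseteq> U" "U - F \<in> lmeasurable" "emeasure lebesgue (U - F) < ennreal (\<epsilon>/4)"
    using sets_lebesgue_outer_open[OF Fl, of "\<epsilon>/4"] \<open>\<epsilon> > 0\<close> by auto
  have "compact K" using K \<open>bounded F\<close> by (simp add: bounded_subset compact_eq_bounded_closed)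
  moreover have "closed (-U)" "K \<inter> -U = {}" using U K by auto
  ultimately obtain d where d: "d > 0" "\<And>x y. x \<in> K \<Longrightarrow> y \<in> -U \<Longrightarrow> d \<le> dist x y"
    by (meson separate_compact_closed)
  have Kb: "F - K \<in> sets borel" and Ub: "U - F \<in> sets borel" using K U Fb by auto
  have Km: "emeasure lborel (F - K) \<le> ennreal (\<epsilon>/4)" and Um: "emeasure lborel (U - F) \<le> ennreal (\<epsilon>/4)"
    using K(4) U(4) Kb Ub by (auto simp: less_imp_le)
  define \<delta> where "\<delta> = min (1/2) (d/2)"
  show thesis
  proof
    show "\<delta> > 0" using d by (simp add: \<delta>_def)
    fix \<beta> :: real and e :: "real \<Rightarrow> real" assume \<beta>: "\<bar>\<beta>\<bar> < \<delta>" and e [measurable]: "e \<in> borel_measurable borel" and ae: "AE x in lborel. \<bar>e x\<bar> < \<delta>"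
    let ?S = "shear \<beta> e"
    let ?B = "((F - K) \<union> (?S -` (U - F))) \<union> ((?S -` (F - K)) \<union> (U - F))"
    have vK: "?S -` (F - K) \<in> sets borel" and vU: "?S -` (U - F) \<in> sets borel"
      using measurable_sets_borel[OF borel_measurable_shear] e Kb Ub by auto
    have "AE p in (lborel :: (real \<times> real) measure). \<bar>e (fst p)\<bar> < \<delta>"
      by (rule AE_lborel_fst[OF ae]) measurable
    then have "AE p in lborel. p \<in> disagree W E ?S \<longrightarrow> p \<in> ?B"
    proof eventually_elim
      case (elim p)
      have ds: "dist p (?S p) \<le> \<bar>\<beta>\<bar> + \<bar>e (fst p)\<bar>"
        by (cases p) (auto simp: shear_def dist_Pair_Pair dist_real_def sqrt_sum_squares_le_sum_abs)
      then have d1: "dist p (?S p) < d" "dist p (?S p) < 1" using \<beta> elim unfolding \<delta>_def by auto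
      show ?case
      proof
        assume p: "p \<in> disagree W E ?S"
        then have "norm p \<le> R" using R by (auto simp: disagree_def)
        moreover have "norm (?S p) \<le> norm p + dist p (?S p)"
          by (metis dist_norm norm_minus_commute norm_triangle_sub)
        ultimately have pF: "p \<in> F \<longleftrightarrow> p \<in> E" "?S p \<in> F \<longleftrightarrow> ?S p \<in> E"
          using d1 by (auto simp: F_def)
        show "p \<in> ?B"
        proof (cases "p \<in> E")
          case True
          then have "?S p \<notin> F" "p \<in> F" using p pF by (auto simp: disagree_def)
          moreover have "?S p \<in> U" if "p \<in> K" using d(2)[OF that, of "?S p"] d1 by auto
          ultimately show ?thesis by auto
        next
          case False
          then have "?S p \<in> F" "p \<notin> F" using p pF by (auto simp: disagree_def)
          moreover have "p \<in> U" if "?S p \<in> K" using d(2)[OF that, of p] d1 by (auto simp: dist_commute)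
          ultimately show ?thesis by auto
        qed
      qed
    qed
    then have "emeasure lborel (disagree W E ?S) \<le> emeasure lborel ?B"
      by (intro emeasure_mono_AE) (use Kb Ub vK vU in auto)
    also have "\<dots> \<le> (emeasure lborel (F - K) + emeasure lborel (?S -` (U - F))) + (emeasure lborel (?S -` (F - K)) + emeasure lborel (U - F))"
      by (intro order_trans[OF emeasure_subadditive] add_mono emeasure_subadditive) (use Kb Ub vK vU in auto)
    also have "\<dots> = (emeasure lborel (F - K) + emeasure lborel (U - F)) + (emeasure lborel (F - K) + emeasure lborel (U - F))"
      using emeasure_shear_vimage[OF e Kb] emeasure_shear_vimage[OF e Ub] by simp
    also have "\<dots> \<le> (ennreal (\<epsilon>/4) + ennreal (\<epsilon>/4)) + (ennreal (\<epsilon>/4) + ennreal (\<epsilon>/4))"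
      by (intro add_mono Km Um)
    also have "\<dots> = ennreal \<epsilon>" using \<open>\<epsilon> > 0\<close> by (simp add: ennreal_plus[symmetric] del: ennreal_plus)
    finally show "emeasure lborel (disagree W E ?S) \<le> ennreal \<epsilon>" .
  qed
qed

section \<open>Almost invariant vertical translations\<close>

lemma nn_integral_period_shift:
  fixes k :: "real \<Rightarrow> ennreal"
  assumes [measurable]: "k \<in> borel_measurable borel" and per: "\<And>x. k (x + 1) = k x"
  shows "(\<integral>\<^sup>+w. k (b + w) * indicator {0..<1} w \<partial>lborel) = (\<integral>\<^sup>+w. k w * indicator {0..<1} w \<partial>lborel)"
proof -
  define c where "c = frac b"
  have c: "0 \<le> c" "c < 1" by (auto simp: c_def frac_lt_1)
  have kb: "k (b + w) = k (c + w)" for w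
    using periodic_of_int[of k 1 "c + w" "\<lfloor>b\<rfloor>"] per by (simp add: c_def frac_def algebra_simps)
  have "(\<integral>\<^sup>+w. k (b + w) * indicator {0..<1} w \<partial>lborel) = (\<integral>\<^sup>+w. k (c + 1 * w) * indicator {c..<1 + c} (c + 1 * w) \<partial>lborel)"
    by (intro nn_integral_cong) (auto simp: kb indicator_def)
  also have "\<dots> = (\<integral>\<^sup>+w. k w * indicator {c..<1 + c} w \<partial>lborel)"
    by (subst nn_integral_real_affine[where c=1 and t=c, of "\<lambda>w. k w * indicator {c..<1 + c} w"]) auto
  also have "\<dots> = (\<integral>\<^sup>+w. k w * indicator {c..<1} w + k w * indicator {1..<1 + c} w \<partial>lborel)"
    using c by (intro nn_integral_cong) (auto simp: indicator_def)
  also have "\<dots> = (\<integral>\<^sup>+w. k w * indicator {c..<1} w \<partial>lborel) + (\<integral>\<^sup>+w. k w * indicator {1..<1 + c} w \<partial>lborel)"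
    by (rule nn_integral_add) auto
  also have "(\<integral>\<^sup>+w. k w * indicator {1..<1 + c} w \<partial>lborel) = (\<integral>\<^sup>+w. k (1 + 1 * w) * indicator {1..<1 + c} (1 + 1 * w) \<partial>lborel)"
    by (subst nn_integral_real_affine[where c=1 and t=1, of "\<lambda>w. k w * indicator {1..<1 + c} w"]) auto
  also have "\<dots> = (\<integral>\<^sup>+w. k w * indicator {0..<c} w \<partial>lborel)"
    by (intro nn_integral_cong) (auto simp: indicator_def per add.commute[of 1])
  also have "(\<integral>\<^sup>+w. k w * indicator {c..<1} w \<partial>lborel) + (\<integral>\<^sup>+w. k w * indicator {0..<c} w \<partial>lborel)
     = (\<integral>\<^sup>+w. k w * indicator {c..<1} w + k w * indicator {0..<c} w \<partial>lborel)"
    by (rule nn_integral_add[symmetric]) auto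
  also have "\<dots> = (\<integral>\<^sup>+w. k w * indicator {0..<1} w \<partial>lborel)"
    using c by (intro nn_integral_cong) (auto simp: indicator_def)
  finally show ?thesis .
qed

lemma birkhoff_sum_borel [measurable]:
  assumes [measurable]: "\<phi> \<in> borel_measurable borel"
  shows "birkhoff_sum \<phi> \<alpha> n \<in> borel_measurable borel"
  unfolding birkhoff_sum_def by measurable

lemma birkhoff_sum_Suc: "birkhoff_sum \<phi> \<alpha> (Suc n) x = birkhoff_sum \<phi> \<alpha> n x + \<phi> (x + n * \<alpha>)"
  by (simp add: birkhoff_sum_def)

lemma skew_invariant_iterate:
  assumes inv: "\<And>x t. (x + \<alpha>, t + \<phi> x) \<in> E \<longleftrightarrow> (x, t) \<in> E"
    and per: "\<And>x t. (x + 1, t) \<in> E \<longleftrightarrow> (x, t) \<in> E"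
  shows "(x + (n * \<alpha> - of_int m), t + birkhoff_sum \<phi> \<alpha> n x) \<in> E \<longleftrightarrow> (x, t) \<in> E"
proof -
  have "(x + n * \<alpha>, t + birkhoff_sum \<phi> \<alpha> n x) \<in> E \<longleftrightarrow> (x, t) \<in> E"
  proof (induction n)
    case (Suc n)
    then show ?case
      using inv[of "x + n * \<alpha>" "t + birkhoff_sum \<phi> \<alpha> n x"]
      by (simp add: birkhoff_sum_Suc algebra_simps)
  qed (simp add: birkhoff_sum_def)
  then show ?thesis
    using periodic_of_int[of "\<lambda>x. (x, t + s) \<in> E" 1 "x + (n * \<alpha> - of_int m)" m for s] per
    by (metis (no_types, lifting) add.assoc diff_add_cancel mult.right_neutral)
qed

text \<open>Averaging over phase shifts \<open>w\<close> decouples the height \<open>\<psi>\<close> of the shear from the position \<open>x\<close>.\<close>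

lemma average_shear_disagree:
  fixes E W :: "(real \<times> real) set"
  assumes [measurable]: "E \<in> sets borel" "W \<in> sets borel" "\<psi> \<in> borel_measurable borel"
    and per: "\<And>x. \<psi> (x + 1) = \<psi> x"
  shows "(\<integral>\<^sup>+w. emeasure lborel (disagree W E (shear 0 (\<lambda>x. \<psi> (x + w)))) * indicator {0..<1} w \<partial>lborel)
       = (\<integral>\<^sup>+w. emeasure lborel (disagree W E (shear 0 (\<lambda>x. \<psi> w))) * indicator {0..<1} w \<partial>lborel)"
proof -
  have [measurable]: "E \<in> sets (borel \<Otimes>\<^sub>M borel)" "W \<in> sets (borel \<Otimes>\<^sub>M borel)"
    using assms(1,2) by (metis borel_prod)+
  define H where "H = (\<lambda>(v :: real) p. indicator {p \<in> W. (p \<in> E) \<noteq> ((fst p, snd p + \<psi> v) \<in> E)} p :: ennreal)"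
  have H1: "(\<lambda>(w, p). H (fst p + w) p * indicator {0..<1} w) \<in> borel_measurable (lborel \<Otimes>\<^sub>M lborel)"
    and H2: "(\<lambda>(w, p). H w p * indicator {0..<1} w) \<in> borel_measurable (lborel \<Otimes>\<^sub>M lborel)"
    unfolding H_def lborel_prod[symmetric] by measurable
  have H3: "(\<lambda>v. H v p) \<in> borel_measurable borel" for p
    unfolding H_def by measurable
  have D1: "emeasure lborel (disagree W E (shear 0 (\<lambda>x. \<psi> (x + w)))) = (\<integral>\<^sup>+p. H (fst p + w) p \<partial>lborel)" for w
  proof -
    have "disagree W E (shear 0 (\<lambda>x. \<psi> (x + w))) \<in> sets lborel" by measurable
    from nn_integral_indicator[OF this] show ?thesis
      by (simp add: H_def disagree_def shear_def indicator_def)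
  qed
  have D2: "emeasure lborel (disagree W E (shear 0 (\<lambda>x. \<psi> w))) = (\<integral>\<^sup>+p. H w p \<partial>lborel)" for w
  proof -
    have "disagree W E (shear 0 (\<lambda>x. \<psi> w)) \<in> sets lborel" by measurable
    from nn_integral_indicator[OF this] show ?thesis
      by (simp add: H_def disagree_def shear_def indicator_def)
  qed
  have "(\<integral>\<^sup>+w. (\<integral>\<^sup>+p. H (fst p + w) p \<partial>lborel) * indicator {0..<1} w \<partial>lborel)
    = (\<integral>\<^sup>+w. \<integral>\<^sup>+p. H (fst p + w) p * indicator {0..<1} w \<partial>lborel \<partial>lborel)"
    by (intro nn_integral_cong) (auto simp: indicator_def)
  also have "\<dots> = (\<integral>\<^sup>+p. \<integral>\<^sup>+w. H (fst p + w) p * indicator {0..<1} w \<partial>lborel \<partial>lborel)"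
    using lborel_pair.Fubini'[OF H1] by simp
  also have "\<dots> = (\<integral>\<^sup>+p. \<integral>\<^sup>+w. H w p * indicator {0..<1} w \<partial>lborel \<partial>lborel)"
    by (intro nn_integral_cong nn_integral_period_shift H3) (simp add: H_def per)
  also have "\<dots> = (\<integral>\<^sup>+w. \<integral>\<^sup>+p. H w p * indicator {0..<1} w \<partial>lborel \<partial>lborel)"
    using lborel_pair.Fubini'[OF H2] by simp
  also have "\<dots> = (\<integral>\<^sup>+w. (\<integral>\<^sup>+p. H w p \<partial>lborel) * indicator {0..<1} w \<partial>lborel)"
    by (intro nn_integral_cong) (auto simp: indicator_def)
  finally show ?thesis by (simp only: D1 D2)
qed

text \<open>Along some times that are almost periods of the rotation, the Birkhoff sums of \<open>\<phi>\<close> are almost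
  functions \<open>\<psi>\<close> that oscillate arbitrarily fast, are bounded by \<open>b\<close>, and reach size \<open>a\<close> on a set of
  measure bounded below.\<close>

definition periodically_approximable :: "(real \<Rightarrow> real) \<Rightarrow> real \<Rightarrow> real \<Rightarrow> real \<Rightarrow> real \<Rightarrow> bool" where
  "periodically_approximable \<phi> \<alpha> a b \<kappa> \<longleftrightarrow> (\<forall>\<eta>>0. \<exists>n (m :: int) \<rho> \<psi>.
     0 < \<rho> \<and> \<rho> < \<eta> \<and> \<psi> \<in> borel_measurable borel \<and>
     (\<forall>x. \<psi> (x + \<rho>) = \<psi> x) \<and> (\<forall>x. \<psi> (x + 1) = \<psi> x) \<and> (\<forall>x. \<bar>\<psi> x\<bar> \<le> b) \<and>
     ennreal \<kappa> \<le> emeasure lborel {w \<in> {0..<1}. a \<le> \<bar>\<psi> w\<bar>} \<and>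
     \<bar>real n * \<alpha> - m\<bar> < \<eta> \<and> (AE x in lborel. \<bar>birkhoff_sum \<phi> \<alpha> n x - \<psi> x\<bar> < \<eta>))"

lemma vertical_quasi_period:
  fixes E W :: "(real \<times> real) set" and a b \<kappa> \<epsilon> :: real
  assumes E [measurable]: "E \<in> sets borel" and \<phi> [measurable]: "\<phi> \<in> borel_measurable borel"
    and inv: "\<And>x t. (x + \<alpha>, t + \<phi> x) \<in> E \<longleftrightarrow> (x, t) \<in> E"
    and per: "\<And>x t. (x + 1, t) \<in> E \<longleftrightarrow> (x, t) \<in> E"
    and "\<kappa> > 0"
    and approx: "periodically_approximable \<phi> \<alpha> a b \<kappa>"
    and W: "bounded W" "W \<in> sets borel" and "\<epsilon> > 0"
  shows "\<exists>s. a \<le> \<bar>s\<bar> \<and> \<bar>s\<bar> \<le> b \<and> emeasure lborel (disagree W E (shear 0 (\<lambda>_. s))) \<le> ennreal \<epsilon>"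
proof -
  note [measurable] = W(2)
  obtain R where R: "\<And>p. p \<in> W \<Longrightarrow> norm p \<le> R"
    using W(1) unfolding bounded_iff by blast
  define W1 :: "(real \<times> real) set" where "W1 = cball 0 (R + b)"
  have W1: "bounded W1" "W1 \<in> sets borel" by (auto simp: W1_def)
  note [measurable] = W1(2)
  obtain \<delta> where \<delta>: "\<delta> > 0"
    "\<And>\<beta> e. \<bar>\<beta>\<bar> < \<delta> \<Longrightarrow> e \<in> borel_measurable borel \<Longrightarrow> AE x in lborel. \<bar>e x\<bar> < \<delta> \<Longrightarrow>
       emeasure lborel (disagree W1 E (shear \<beta> e)) \<le> ennreal (\<epsilon> * \<kappa> / 4)"
    using small_shear_disagree[OF E W1, of "\<epsilon> * \<kappa> / 4"] \<open>\<epsilon> > 0\<close> \<open>\<kappa> > 0\<close> by auto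
  obtain n and m :: int and \<rho> \<psi> where *: "0 < \<rho>" "\<rho> < \<delta> / 2" "\<psi> \<in> borel_measurable borel"
    "\<And>x. \<psi> (x + \<rho>) = \<psi> x" "\<And>x. \<psi> (x + 1) = \<psi> x" "\<And>x. \<bar>\<psi> x\<bar> \<le> b"
    "ennreal \<kappa> \<le> emeasure lborel {w \<in> {0..<1}. a \<le> \<bar>\<psi> w\<bar>}"
    "\<bar>real n * \<alpha> - m\<bar> < \<delta> / 2" "AE x in lborel. \<bar>birkhoff_sum \<phi> \<alpha> n x - \<psi> x\<bar> < \<delta> / 2"
    using approx[unfolded periodically_approximable_def, rule_format, of "\<delta> / 2"] \<delta>(1) by auto
  note [measurable] = *(3)
  define c where "c = birkhoff_sum \<phi> \<alpha> n"
  have [measurable]: "c \<in> borel_measurable borel" unfolding c_def by measurable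
  define \<beta> where "\<beta> = real n * \<alpha> - m"
  have small: "emeasure lborel (disagree W E (shear 0 (\<lambda>x. \<psi> (x + u)))) \<le> ennreal (\<epsilon> * \<kappa> / 2)"
    if u: "0 \<le> u" "u < \<rho>" for u
  proof -
    let ?S = "shear 0 (\<lambda>x. \<psi> (x + u))" and ?T = "shear (u + \<beta>) (\<lambda>x. c (x + u) - \<psi> (x + u))"
    have ST: "?S -` disagree W1 E ?T \<in> sets borel"
      by (rule measurable_sets_borel[OF borel_measurable_shear]) measurable
    have "disagree W E ?S \<subseteq> ?S -` disagree W1 E ?T \<union> disagree W1 E (shear u (\<lambda>_. 0))"
    proof
      fix p assume p: "p \<in> disagree W E ?S"
      obtain x t where xt: "p = (x, t)" by fastforce
      have "norm p \<le> R" using p R by (auto simp: disagree_def)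
      moreover have "norm (?S p) \<le> norm p + norm (0 :: real, \<psi> (x + u))"
        using norm_triangle_ineq[of p "(0, \<psi> (x + u))"] by (simp add: shear_def xt)
      moreover have "\<bar>\<psi> (x + u)\<bar> \<le> b" by (rule *)
      moreover have "b \<ge> 0" using *(6)[of 0] by linarith
      ultimately have "p \<in> W1" "?S p \<in> W1" by (auto simp: W1_def)
      moreover have "?T (?S p) \<in> E \<longleftrightarrow> shear u (\<lambda>_. 0) p \<in> E"
        using skew_invariant_iterate[OF inv per, of "x + u" n m t]
        by (simp add: xt shear_def c_def \<beta>_def algebra_simps)
      ultimately show "p \<in> ?S -` disagree W1 E ?T \<union> disagree W1 E (shear u (\<lambda>_. 0))"
        using p by (auto simp: disagree_def)
    qed
    then have "emeasure lborel (disagree W E ?S)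
      \<le> emeasure lborel (?S -` disagree W1 E ?T \<union> disagree W1 E (shear u (\<lambda>_. 0)))"
      by (rule emeasure_mono) (use ST in measurable)
    also have "\<dots> \<le> emeasure lborel (?S -` disagree W1 E ?T) + emeasure lborel (disagree W1 E (shear u (\<lambda>_. 0)))"
      by (rule emeasure_subadditive) (use ST in measurable)
    also have "emeasure lborel (?S -` disagree W1 E ?T) = emeasure lborel (disagree W1 E ?T)"
      by (rule emeasure_shear_vimage) measurable
    also have "\<dots> \<le> ennreal (\<epsilon> * \<kappa> / 4)"
    proof (rule \<delta>(2))
      show "\<bar>u + \<beta>\<bar> < \<delta>" using u * unfolding \<beta>_def by linarith
      have "AE x in lborel. \<bar>c (u + 1 * x) - \<psi> (u + 1 * x)\<bar> < \<delta> / 2"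
        by (rule AE_borel_affine[where P="\<lambda>x. \<bar>c x - \<psi> x\<bar> < \<delta> / 2"]) (use *(9) in \<open>auto simp: c_def\<close>)
      then show "AE x in lborel. \<bar>c (x + u) - \<psi> (x + u)\<bar> < \<delta>"
        by eventually_elim (use \<delta>(1) in \<open>simp add: add.commute\<close>)
    qed measurable
    also have "emeasure lborel (disagree W1 E (shear u (\<lambda>_. 0))) \<le> ennreal (\<epsilon> * \<kappa> / 4)"
      by (rule \<delta>(2)) (use u * \<delta>(1) in auto)
    also have "ennreal (\<epsilon> * \<kappa> / 4) + ennreal (\<epsilon> * \<kappa> / 4) = ennreal (\<epsilon> * \<kappa> / 2)"
      using \<open>\<epsilon> > 0\<close> \<open>\<kappa> > 0\<close> by (simp add: ennreal_plus[symmetric] del: ennreal_plus)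
    finally show ?thesis by (simp add: add_mono)
  qed
  have small': "emeasure lborel (disagree W E (shear 0 (\<lambda>x. \<psi> (x + w)))) \<le> ennreal (\<epsilon> * \<kappa> / 2)" for w
  proof -
    define u where "u = \<rho> * frac (w / \<rho>)"
    have "0 \<le> u" "u < \<rho>" using * by (auto simp: u_def frac_lt_1)
    moreover have "w = u + of_int \<lfloor>w / \<rho>\<rfloor> * \<rho>" using * by (simp add: u_def frac_def field_simps)
    then have "\<psi> (x + w) = \<psi> (x + u)" for x
      using periodic_of_int[of \<psi> \<rho> "x + u" "\<lfloor>w / \<rho>\<rfloor>"] *(4) by (simp add: add.assoc)
    ultimately show ?thesis using small by simp
  qed
  show ?thesis
  proof (rule ccontr)
    assume "\<not> ?thesis"
    then have big: "ennreal \<epsilon> \<le> emeasure lborel (disagree W E (shear 0 (\<lambda>_. \<psi> w)))" if "a \<le> \<bar>\<psi> w\<bar>" for w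
      using that *(6)[of w] by (meson linorder_le_cases)
    have "ennreal (\<epsilon> * \<kappa>) = ennreal \<epsilon> * ennreal \<kappa>" using \<open>\<epsilon> > 0\<close> \<open>\<kappa> > 0\<close> by (simp add: ennreal_mult)
    also have "\<dots> \<le> ennreal \<epsilon> * emeasure lborel {w \<in> {0..<1}. a \<le> \<bar>\<psi> w\<bar>}" by (intro mult_left_mono *) auto
    also have "\<dots> = (\<integral>\<^sup>+w. ennreal \<epsilon> * indicator {w \<in> {0..<1}. a \<le> \<bar>\<psi> w\<bar>} w \<partial>lborel)"
      by (subst nn_integral_cmult_indicator) auto
    also have "\<dots> \<le> (\<integral>\<^sup>+w. emeasure lborel (disagree W E (shear 0 (\<lambda>_. \<psi> w))) * indicator {0..<1} w \<partial>lborel)"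
      by (intro nn_integral_mono) (auto simp: indicator_def big)
    also have "\<dots> = (\<integral>\<^sup>+w. emeasure lborel (disagree W E (shear 0 (\<lambda>x. \<psi> (x + w)))) * indicator {0..<1} w \<partial>lborel)"
      by (rule average_shear_disagree[symmetric]) (use * in auto)
    also have "\<dots> \<le> (\<integral>\<^sup>+w. ennreal (\<epsilon> * \<kappa> / 2) * indicator {0..<1 :: real} w \<partial>lborel)"
      by (intro nn_integral_mono mult_right_mono small') auto
    also have "\<dots> = ennreal (\<epsilon> * \<kappa> / 2)" by (subst nn_integral_cmult_indicator) auto
    finally show False using \<open>\<epsilon> > 0\<close> \<open>\<kappa> > 0\<close> by (simp add: ennreal_le_iff)
  qed
qed

section \<open>Periods of a plane set\<close>

lemma closed_real_subgroup_UNIV: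
  fixes S :: "real set"
  assumes "closed S" "0 \<in> S" and add: "\<And>x y. x \<in> S \<Longrightarrow> y \<in> S \<Longrightarrow> x + y \<in> S"
    and minus: "\<And>x. x \<in> S \<Longrightarrow> - x \<in> S"
    and small: "\<And>\<epsilon>. \<epsilon> > 0 \<Longrightarrow> \<exists>s\<in>S. s \<noteq> 0 \<and> \<bar>s\<bar> < \<epsilon>"
  shows "S = UNIV"
proof -
  have nat: "real n * s \<in> S" if "s \<in> S" for n s
    by (induction n) (auto simp: assms(2) algebra_simps intro: add that)
  have int: "of_int k * s \<in> S" if "s \<in> S" for k s
  proof (cases "k \<ge> 0")
    case True
    then show ?thesis using nat[OF that, of "nat k"] by simp
  next
    case False
    then show ?thesis using minus[OF nat[OF that, of "nat (-k)"]] by simp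
  qed
  have "x \<in> closure S" for x
    unfolding closure_approachable
  proof (intro allI impI)
    fix \<epsilon> :: real assume "\<epsilon> > 0"
    then obtain s where s: "s \<in> S" "s \<noteq> 0" "\<bar>s\<bar> < \<epsilon>" using small by blast
    have "\<bar>of_int \<lfloor>x / s\<rfloor> * s - x\<bar> = \<bar>frac (x / s)\<bar> * \<bar>s\<bar>"
      using s(2) by (simp add: abs_mult[symmetric] frac_def field_simps)
    also have "\<dots> \<le> 1 * \<bar>s\<bar>"
      by (intro mult_right_mono) (simp_all add: abs_of_nonneg frac_lt_1 less_imp_le)
    finally show "\<exists>y\<in>S. dist y x < \<epsilon>"
      using int[OF s(1)] s(3) by (intro bexI[of _ "of_int \<lfloor>x / s\<rfloor> * s"]) (auto simp: dist_real_def)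
  qed
  then show ?thesis using assms(1) by auto
qed

definition set_period :: "(real \<times> real) set \<Rightarrow> real \<times> real \<Rightarrow> bool" where
  "set_period E v \<longleftrightarrow> (AE p in lborel. p \<in> E \<longleftrightarrow> p + v \<in> E)"

lemma shear_const: "shear \<beta> (\<lambda>_. s) = (\<lambda>p. p + (\<beta>, s))"
  by (auto simp: shear_def fun_eq_iff)

lemma set_period_0: "set_period E 0"
  by (simp add: set_period_def)

lemma AE_translate:
  fixes v :: "real \<times> real"
  assumes "Measurable.pred borel P" "AE p in lborel. P p"
  shows "AE p in lborel. P (p + v)"
  using AE_shear[OF _ assms, of "\<lambda>_. snd v" "fst v"] by (simp add: shear_const)

lemma set_period_uminus:
  assumes [measurable]: "E \<in> sets borel" and "set_period E v"
  shows "set_period E (- v)"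
proof -
  have "AE p in lborel. p + - v \<in> E \<longleftrightarrow> p + - v + v \<in> E"
    by (rule AE_translate[where P="\<lambda>p. p \<in> E \<longleftrightarrow> p + v \<in> E"])
      (use assms(2) in \<open>auto simp: set_period_def\<close>)
  then show ?thesis unfolding set_period_def by eventually_elim simp
qed

lemma set_period_add:
  assumes [measurable]: "E \<in> sets borel" and "set_period E v" "set_period E w"
  shows "set_period E (v + w)"
proof -
  have "AE p in lborel. p + v \<in> E \<longleftrightarrow> p + v + w \<in> E"
    by (rule AE_translate[where P="\<lambda>p. p \<in> E \<longleftrightarrow> p + w \<in> E"])
      (use assms(3) in \<open>auto simp: set_period_def\<close>)
  with assms(2) show ?thesis unfolding set_period_def
    by eventually_elim (simp add: add.assoc)
qed

lemma set_period_limit: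
  fixes v :: "real \<times> real"
  assumes E [measurable]: "E \<in> sets borel"
    and approx: "\<And>R \<epsilon> \<eta>. \<epsilon> > 0 \<Longrightarrow> \<eta> > 0 \<Longrightarrow>
      \<exists>w. dist w v < \<eta> \<and> emeasure lborel (disagree (cball 0 R) E (\<lambda>p. p + w)) \<le> ennreal \<epsilon>"
  shows "set_period E v"
proof -
  have small: "emeasure lborel (disagree (cball 0 R) E (\<lambda>p. p + v)) \<le> 0 + ennreal \<epsilon>" if "\<epsilon> > 0" for R \<epsilon>
  proof -
    let ?W = "cball 0 (R + norm v + 1) :: (real \<times> real) set"
    obtain \<delta> where \<delta>: "\<delta> > 0"
      "\<And>\<beta> e. \<bar>\<beta>\<bar> < \<delta> \<Longrightarrow> e \<in> borel_measurable borel \<Longrightarrow> AE x in lborel. \<bar>e x\<bar> < \<delta> \<Longrightarrow>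
         emeasure lborel (disagree ?W E (shear \<beta> e)) \<le> ennreal (\<epsilon> / 2)"
      using small_shear_disagree[OF E, of ?W "\<epsilon> / 2"] \<open>\<epsilon> > 0\<close> by auto
    obtain w where w: "dist w v < min \<delta> 1"
      "emeasure lborel (disagree (cball 0 R) E (\<lambda>p. p + w)) \<le> ennreal (\<epsilon> / 2)"
      using approx[of "\<epsilon> / 2" "min \<delta> 1" R] \<delta>(1) \<open>\<epsilon> > 0\<close> by auto
    let ?D = "disagree ?W E (\<lambda>p. p + (v - w))"
    have D: "?D \<in> sets borel" by measurable
    have V: "(\<lambda>p. p + w) -` ?D \<in> sets borel"
      by (rule measurable_sets_borel[OF _ D]) measurable
    have "disagree (cball 0 R) E (\<lambda>p. p + v) \<subseteq> disagree (cball 0 R) E (\<lambda>p. p + w) \<union> (\<lambda>p. p + w) -` ?D"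
    proof
      fix p assume p: "p \<in> disagree (cball 0 R) E (\<lambda>p. p + v)"
      have "norm (p + w) \<le> norm p + (norm v + dist w v)"
        by (metis add_left_mono dist_norm norm_triangle_ineq norm_triangle_sub order_trans)
      then have "p + w \<in> ?W" using p w by (auto simp: disagree_def)
      moreover have "p + w + (v - w) = p + v" by simp
      ultimately show "p \<in> disagree (cball 0 R) E (\<lambda>p. p + w) \<union> (\<lambda>p. p + w) -` ?D"
        using p unfolding disagree_def by auto
    qed
    then have "emeasure lborel (disagree (cball 0 R) E (\<lambda>p. p + v))
      \<le> emeasure lborel (disagree (cball 0 R) E (\<lambda>p. p + w) \<union> (\<lambda>p. p + w) -` ?D)"
      by (rule emeasure_mono) (use V in measurable)
    also have "\<dots> \<le> emeasure lborel (disagree (cball 0 R) E (\<lambda>p. p + w)) + emeasure lborel ((\<lambda>p. p + w) -` ?D)"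
      by (rule emeasure_subadditive) (use V in measurable)
    also have "emeasure lborel ((\<lambda>p. p + w) -` ?D) = emeasure lborel ?D"
      using emeasure_shear_vimage[of "\<lambda>_. snd w" ?D "fst w"] D by (simp add: shear_const)
    also have "?D = disagree ?W E (shear (fst (v - w)) (\<lambda>_. snd (v - w)))"
      by (simp add: shear_const del: fst_diff snd_diff)
    also have "emeasure lborel \<dots> \<le> ennreal (\<epsilon> / 2)"
    proof (rule \<delta>(2))
      have "norm (v - w) < \<delta>" using w by (simp add: dist_norm norm_minus_commute)
      then show "\<bar>fst (v - w)\<bar> < \<delta>" "AE x in lborel. \<bar>snd (v - w)\<bar> < \<delta>"
        using norm_fst_le[of "fst (v - w)" "snd (v - w)"] norm_snd_le[of "snd (v - w)" "fst (v - w)"]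
        by (auto simp del: fst_diff snd_diff)
    qed auto
    finally have "emeasure lborel (disagree (cball 0 R) E (\<lambda>p. p + v)) \<le> ennreal (\<epsilon> / 2) + ennreal (\<epsilon> / 2)"
      using w(2) by (meson add_mono order_refl order_trans)
    then show ?thesis using \<open>\<epsilon> > 0\<close> by (simp add: ennreal_plus[symmetric] del: ennreal_plus)
  qed
  have "emeasure lborel (disagree (cball 0 R) E (\<lambda>p. p + v)) = 0" for R
    using ennreal_le_epsilon[of 0, OF small] by simp
  then have "AE p in lborel. p \<notin> disagree (cball 0 (real k)) E (\<lambda>p. p + v)" for k
    by (intro AE_not_in) (auto simp: null_sets_def)
  then have "AE p in lborel. \<forall>k. p \<notin> disagree (cball 0 (real k)) E (\<lambda>p. p + v)"
    by (simp add: AE_all_countable)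
  then show ?thesis unfolding set_period_def
  proof eventually_elim
    case (elim p)
    obtain k where "norm p \<le> real k" using real_arch_simple by blast
    then show ?case using elim by (auto simp: disagree_def)
  qed
qed

lemma set_period_closed:
  assumes [measurable]: "E \<in> sets borel"
  shows "closed {v. set_period E v}"
  unfolding closed_sequential_limits
proof (intro allI impI)
  fix X v assume X: "(\<forall>n. X n \<in> {v. set_period E v}) \<and> X \<longlonglongrightarrow> v"
  show "v \<in> {v. set_period E v}"
  proof (simp, rule set_period_limit)
    fix R \<epsilon> \<eta> :: real assume "\<epsilon> > 0" "\<eta> > 0"
    then obtain n where n: "dist (X n) v < \<eta>" using X by (meson lim_sequentially order_refl)
    have "AE p in lborel. p \<in> E \<longleftrightarrow> p + X n \<in> E" using X by (simp add: set_period_def)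
    then have "AE p in lborel. p \<notin> disagree (cball 0 R) E (\<lambda>p. p + X n)"
      by eventually_elim (simp add: disagree_def)
    then have "emeasure lborel (disagree (cball 0 R) E (\<lambda>p. p + X n)) = 0"
      by (subst (asm) AE_iff_measurable[OF _ refl]) (auto simp: disagree_def)
    then show "\<exists>w. dist w v < \<eta> \<and> emeasure lborel (disagree (cball 0 R) E (\<lambda>p. p + w)) \<le> ennreal \<epsilon>"
      using n by (intro exI[of _ "X n"]) simp
  qed (rule assms)
qed

lemma set_period_line_UNIV:
  assumes E: "E \<in> sets borel"
    and small: "\<And>\<epsilon>. \<epsilon> > 0 \<Longrightarrow> \<exists>s. set_period E (s *\<^sub>R v) \<and> s \<noteq> 0 \<and> \<bar>s\<bar> < \<epsilon>"
  shows "set_period E (s *\<^sub>R v)"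
proof -
  have "{s. set_period E (s *\<^sub>R v)} = UNIV"
  proof (rule closed_real_subgroup_UNIV)
    have "closed ((\<lambda>s. s *\<^sub>R v) -` {v. set_period E v})"
      by (intro closed_vimage set_period_closed E continuous_intros)
    then show "closed {s. set_period E (s *\<^sub>R v)}" by (simp add: vimage_def)
  qed (use small set_period_0 in \<open>auto simp: scaleR_add_left intro: set_period_add[OF E] set_period_uminus[OF E]\<close>)
  then show ?thesis by blast
qed

lemma vertical_period_exists:
  fixes a b :: real
  assumes E: "E \<in> sets borel"
    and quasi: "\<And>W \<epsilon>. bounded W \<Longrightarrow> W \<in> sets borel \<Longrightarrow> \<epsilon> > 0 \<Longrightarrow>
      \<exists>s. a \<le> \<bar>s\<bar> \<and> \<bar>s\<bar> \<le> b \<and> emeasure lborel (disagree W E (shear 0 (\<lambda>_. s))) \<le> ennreal \<epsilon>"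
  shows "\<exists>s. a \<le> \<bar>s\<bar> \<and> \<bar>s\<bar> \<le> b \<and> set_period E (0, s)"
proof -
  have "\<forall>k. \<exists>s. a \<le> \<bar>s\<bar> \<and> \<bar>s\<bar> \<le> b \<and>
      emeasure lborel (disagree (cball 0 (real k)) E (\<lambda>p. p + (0, s))) \<le> ennreal (inverse (real (Suc k)))"
  proof
    fix k show "\<exists>s. a \<le> \<bar>s\<bar> \<and> \<bar>s\<bar> \<le> b \<and>
      emeasure lborel (disagree (cball 0 (real k)) E (\<lambda>p. p + (0, s))) \<le> ennreal (inverse (real (Suc k)))"
      using quasi[of "cball 0 (real k)" "inverse (real (Suc k))"] by (simp add: shear_const)
  qed
  then obtain s where s: "\<And>k. a \<le> \<bar>s k\<bar>" "\<And>k. \<bar>s k\<bar> \<le> b"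
      "\<And>k. emeasure lborel (disagree (cball 0 (real k)) E (\<lambda>p. p + (0, s k))) \<le> ennreal (inverse (real (Suc k)))"
    by metis
  have "closed {x. a \<le> \<bar>x\<bar> \<and> \<bar>x\<bar> \<le> b}"
    by (intro closed_Collect_conj closed_Collect_le continuous_intros)
  moreover have "bounded {x. a \<le> \<bar>x\<bar> \<and> \<bar>x\<bar> \<le> b}" unfolding bounded_iff by auto
  ultimately have "compact {x. a \<le> \<bar>x\<bar> \<and> \<bar>x\<bar> \<le> b}" by (simp add: compact_eq_bounded_closed)
  moreover have "\<forall>k. s k \<in> {x. a \<le> \<bar>x\<bar> \<and> \<bar>x\<bar> \<le> b}" using s by simp
  ultimately obtain l r where l: "l \<in> {x. a \<le> \<bar>x\<bar> \<and> \<bar>x\<bar> \<le> b}" "strict_mono (r :: nat \<Rightarrow> nat)"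
    and lim: "(s \<circ> r) \<longlonglongrightarrow> l"
    by (meson compact_imp_seq_compact seq_compactE)
  have "set_period E (0, l)"
  proof (rule set_period_limit[OF E])
    fix R \<epsilon> \<eta> :: real assume "\<epsilon> > 0" "\<eta> > 0"
    have "\<forall>\<^sub>F k in sequentially. dist (s (r k)) l < \<eta>"
      using tendstoD[OF lim \<open>\<eta> > 0\<close>] by simp
    moreover have "\<forall>\<^sub>F k in sequentially. inverse (real (Suc k)) < \<epsilon>"
      using order_tendstoD(2)[OF LIMSEQ_inverse_real_of_nat \<open>\<epsilon> > 0\<close>] by simp
    moreover have "\<forall>\<^sub>F k in sequentially. R \<le> real k"
      using filterlim_real_sequentially by (simp add: filterlim_at_top)
    ultimately have "\<forall>\<^sub>F k in sequentially. dist (s (r k)) l < \<eta> \<and> inverse (real (Suc k)) < \<epsilon> \<and> R \<le> real k"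
      by eventually_elim simp
    then obtain k where k: "dist (s (r k)) l < \<eta>" "inverse (real (Suc k)) < \<epsilon>" "R \<le> real k"
      by (auto simp: eventually_sequentially)
    have rk: "k \<le> r k" using l(2) by (rule seq_suble)
    have D: "disagree (cball 0 (real (r k))) E (\<lambda>p. p + (0, s (r k))) \<in> sets lborel"
      using disagree_borel[OF E, of "cball 0 (real (r k))" "\<lambda>p. p + (0, s (r k))"] by simp
    have "emeasure lborel (disagree (cball 0 R) E (\<lambda>p. p + (0, s (r k))))
      \<le> emeasure lborel (disagree (cball 0 (real (r k))) E (\<lambda>p. p + (0, s (r k))))"
      by (rule emeasure_mono[OF _ D]) (use k(3) rk in \<open>auto simp: disagree_def\<close>)
    also have "\<dots> \<le> ennreal (inverse (real (Suc (r k))))" by (rule s)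
    also have "\<dots> \<le> ennreal \<epsilon>"
    proof (rule ennreal_leI)
      have "inverse (real (Suc (r k))) \<le> inverse (real (Suc k))"
        by (rule le_imp_inverse_le) (use rk in auto)
      then show "inverse (real (Suc (r k))) \<le> \<epsilon>" using k(2) by linarith
    qed
    finally show "\<exists>w. dist w (0, l) < \<eta> \<and> emeasure lborel (disagree (cball 0 R) E (\<lambda>p. p + w)) \<le> ennreal \<epsilon>"
      using k(1) by (intro exI[of _ "(0, s (r k))"]) (simp add: dist_Pair_Pair)
  qed
  then show ?thesis using l by blast
qed

section \<open>A criterion for ergodicity\<close>

lemma AE_lborel_ex:
  assumes "AE x in (lborel :: 'a :: euclidean_space measure). P x"
  shows "\<exists>x. P x"
proof (rule ccontr)
  assume "\<nexists>x. P x"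
  then have "AE x in (lborel :: 'a measure). False" using assms by simp
  then have "emeasure (lborel :: 'a measure) UNIV = 0"
    by (subst (asm) AE_iff_measurable[OF _ refl]) auto
  then show False by simp
qed

lemma AE_AE_swap:
  fixes P :: "'a :: euclidean_space \<Rightarrow> 'b :: euclidean_space \<Rightarrow> bool"
  assumes "Measurable.pred (borel \<Otimes>\<^sub>M borel) (\<lambda>(x, y). P x y)" "\<And>x. AE y in lborel. P x y"
  shows "AE y in lborel. AE x in lborel. P x y"
proof -
  have "sets (lborel \<Otimes>\<^sub>M lborel) = sets (borel \<Otimes>\<^sub>M (borel :: 'b measure) :: ('a \<times> 'b) measure)"
    by (intro sets_pair_measure_cong) auto
  then have "{z \<in> space (lborel \<Otimes>\<^sub>M lborel). P (fst z) (snd z)} \<in> sets (lborel \<Otimes>\<^sub>M lborel)"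
    using assms(1) by (auto simp: pred_def space_pair_measure case_prod_unfold)
  from lborel_pair.AE_commute[OF this] show ?thesis using assms(2) by simp
qed

lemma AE_all_vertical_shifts:
  assumes "E \<in> sets borel" and per: "\<And>c. set_period E (0, c)" and [measurable]: "e \<in> borel_measurable borel"
  shows "AE p in lborel. p \<in> E \<longleftrightarrow> shear 0 e p \<in> E"
proof -
  have [measurable]: "E \<in> sets (borel \<Otimes>\<^sub>M borel)"
    using assms(1) by (metis borel_prod)
  note [measurable] = assms(1)
  have m: "Measurable.pred (borel \<Otimes>\<^sub>M borel) (\<lambda>(c :: real, p). p \<in> E \<longleftrightarrow> p + (0, c) \<in> E)"
    unfolding borel_prod[symmetric] plus_prod_def fst_conv snd_conv by measurable
  have "AE p in lborel. AE c in lborel. p \<in> E \<longleftrightarrow> p + (0, c) \<in> E"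
    by (rule AE_AE_swap[OF m]) (use per in \<open>auto simp: set_period_def\<close>)
  then have "AE x in lborel. AE t in lborel. AE c in lborel. (x, t) \<in> E \<longleftrightarrow> (x, t) + (0, c) \<in> E"
    by (intro lborel_pair.AE_pair) (simp only: lborel_prod)
  then have "AE x in lborel. AE t in lborel. (x, t) \<in> E \<longleftrightarrow> shear 0 e (x, t) \<in> E"
  proof eventually_elim
    case (elim x)
    have [measurable]: "Measurable.pred borel (\<lambda>t. (x, t) \<in> E)"
      using measurable_section[OF assms(1), of x] by (simp add: pred_def)
    from AE_lborel_ex[OF elim] obtain t0 where "AE c in lborel. (x, t0) \<in> E \<longleftrightarrow> (x, t0 + c) \<in> E"
      by auto
    then have "AE t in lborel. (x, t0) \<in> E \<longleftrightarrow> (x, t0 + (s - t0 + 1 * t)) \<in> E" for s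
      by (intro AE_borel_affine[where P="\<lambda>c. (x, t0) \<in> E \<longleftrightarrow> (x, t0 + c) \<in> E"]) auto
    then have const: "AE t in lborel. (x, t0) \<in> E \<longleftrightarrow> (x, t + s) \<in> E" for s
      by (simp add: add.commute[of _ s])
    from const[of 0] const[of "e x"] show ?case
      by eventually_elim (simp add: shear_def)
  qed
  then show ?thesis by (subst AE_lborel_pair_iff) auto
qed

lemma set_period_all_imp_trivial:
  assumes "E \<in> sets borel" and per: "\<And>v. set_period E v"
  shows "(AE p in lborel. p \<in> E) \<or> (AE p in lborel. p \<notin> E)"
proof -
  have [measurable]: "E \<in> sets (borel \<Otimes>\<^sub>M borel)"
    using assms(1) by (metis borel_prod)
  note [measurable] = assms(1)
  have m: "Measurable.pred (borel \<Otimes>\<^sub>M borel) (\<lambda>(v, p). p \<in> E \<longleftrightarrow> p + v \<in> E)"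
    unfolding borel_prod[symmetric] plus_prod_def fst_conv snd_conv by measurable
  have "AE p in lborel. AE v in lborel. p \<in> E \<longleftrightarrow> p + v \<in> E"
    by (rule AE_AE_swap[OF m]) (use per in \<open>auto simp: set_period_def\<close>)
  then obtain p where p: "AE v in lborel. p \<in> E \<longleftrightarrow> p + v \<in> E" using AE_lborel_ex by blast
  have "AE q in lborel. p \<in> E \<longleftrightarrow> p + (q + - p) \<in> E"
    by (rule AE_translate[OF _ p]) measurable
  then have "AE q in lborel. p \<in> E \<longleftrightarrow> q \<in> E" by simp
  then show ?thesis by (cases "p \<in> E") simp_all
qed

lemma set_period_of_int:
  assumes E: "E \<in> sets borel" and v: "set_period E v"
  shows "set_period E (of_int k *\<^sub>R v)"
proof (induction k rule: int_induct[where k=0])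
  case (step1 i)
  then show ?case using set_period_add[OF E _ v] by (simp add: scaleR_add_left)
next
  case (step2 i)
  then show ?case using set_period_add[OF E _ set_period_uminus[OF E v]] by (simp add: scaleR_diff_left)
qed (simp add: set_period_0)

lemma irrational_small_combination:
  fixes \<alpha> \<epsilon> :: real
  assumes "\<alpha> \<notin> \<rat>" "\<epsilon> > 0"
  obtains k h :: int where "of_int k * \<alpha> - of_int h \<noteq> 0" "\<bar>of_int k * \<alpha> - of_int h\<bar> < \<epsilon>"
proof -
  obtain N where N: "N > 0" "1 / real N < \<epsilon>"
    using \<open>\<epsilon> > 0\<close> by (metis nat_approx_posE of_nat_0_less_iff zero_less_Suc)
  obtain h k where hk: "0 < k" "k \<le> int N" "\<bar>of_int k * \<alpha> - of_int h\<bar> < 1 / N"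
    using Dirichlet_approx[OF N(1)] by blast
  have "of_int k * \<alpha> - of_int h \<noteq> 0"
  proof
    assume "of_int k * \<alpha> - of_int h = 0"
    then have "\<alpha> = of_int h / of_int k" using hk(1) by (simp add: field_simps)
    then show False using assms(1) by simp
  qed
  then show ?thesis using that hk(3) N(2) by force
qed

lemma invariant_set_trivial:
  fixes E :: "(real \<times> real) set"
  assumes E [measurable]: "E \<in> sets borel" and \<phi> [measurable]: "\<phi> \<in> borel_measurable borel" and "\<alpha> \<notin> \<rat>"
    and inv: "\<And>x t. (x + \<alpha>, t + \<phi> x) \<in> E \<longleftrightarrow> (x, t) \<in> E"
    and per: "\<And>x t. (x + 1, t) \<in> E \<longleftrightarrow> (x, t) \<in> E"
    and approx: "\<And>b. b > 0 \<Longrightarrow> \<exists>a \<kappa>. a > 0 \<and> \<kappa> > 0 \<and> periodically_approximable \<phi> \<alpha> a b \<kappa>"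
  shows "(AE p in lborel. p \<in> E) \<or> (AE p in lborel. p \<notin> E)"
proof (rule set_period_all_imp_trivial[OF E])
  have vert: "set_period E (0, s)" for s
  proof -
    have "set_period E (s *\<^sub>R (0, 1))"
    proof (rule set_period_line_UNIV[OF E])
      fix \<epsilon> :: real assume "\<epsilon> > 0"
      then obtain a \<kappa> where a: "a > 0" "\<kappa> > 0" "periodically_approximable \<phi> \<alpha> a (\<epsilon> / 2) \<kappa>"
        using approx[of "\<epsilon> / 2"] by auto
      have "\<exists>s. a \<le> \<bar>s\<bar> \<and> \<bar>s\<bar> \<le> \<epsilon> / 2 \<and> set_period E (0, s)"
        by (rule vertical_period_exists[OF E vertical_quasi_period[OF E \<phi> inv per a(2,3)]])
      then show "\<exists>s. set_period E (s *\<^sub>R (0, 1)) \<and> s \<noteq> 0 \<and> \<bar>s\<bar> < \<epsilon>"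
        using a(1) \<open>\<epsilon> > 0\<close> by force
    qed
    then show ?thesis by simp
  qed
  have "AE p in lborel. p \<in> E \<longleftrightarrow> shear 0 (\<lambda>x. \<phi> (x - \<alpha>)) p \<in> E"
    by (rule AE_all_vertical_shifts[OF E vert]) measurable
  then have "AE p in lborel. p + (\<alpha>, 0) \<in> E \<longleftrightarrow> shear 0 (\<lambda>x. \<phi> (x - \<alpha>)) (p + (\<alpha>, 0)) \<in> E"
    by (intro AE_translate[where P="\<lambda>p. p \<in> E \<longleftrightarrow> shear 0 (\<lambda>x. \<phi> (x - \<alpha>)) p \<in> E"]) measurable
  then have "set_period E (\<alpha>, 0)"
    unfolding set_period_def
  proof eventually_elim
    case (elim p)
    then show ?case using inv[of "fst p" "snd p"] by (cases p) (simp add: shear_def)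
  qed
  moreover have "set_period E (1, 0)"
    unfolding set_period_def using per by (intro AE_I2) (metis add.right_neutral add_Pair surj_pair)
  ultimately have comb: "set_period E ((of_int k * \<alpha> - of_int h) *\<^sub>R (1, 0))" for k h :: int
    using set_period_add[OF E set_period_of_int[OF E, of "(\<alpha>, 0)" k] set_period_of_int[OF E, of "(1, 0)" "- h"]]
    by simp
  have horiz: "set_period E (s *\<^sub>R (1, 0))" for s
    by (rule set_period_line_UNIV[OF E]) (metis comb irrational_small_combination \<open>\<alpha> \<notin> \<rat>\<close>)
  show "set_period E v" for v
    using set_period_add[OF E horiz[of "fst v"] vert[of "snd v"]] by simp
qed

lemma ergodic_skew_criterion:
  assumes \<phi> [measurable]: "\<phi> \<in> borel_measurable borel" and \<phi>per: "\<And>x. \<phi> (x + 1) = \<phi> x" and "\<alpha> \<notin> \<rat>"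
    and approx: "\<And>b. b > 0 \<Longrightarrow> \<exists>a \<kappa>. a > 0 \<and> \<kappa> > 0 \<and> periodically_approximable \<phi> \<alpha> a b \<kappa>"
  shows "ergodic_skew \<alpha> \<phi>"
  unfolding ergodic_skew_def
proof (intro ballI impI)
  fix A assume A: "A \<in> sets TxR_measure" and inv: "skew_map \<alpha> \<phi> -` A \<inter> space TxR_measure = A"
  let ?S = "{0..<1} \<times> UNIV :: (real \<times> real) set"
  have sp: "space TxR_measure = ?S"
    by (auto simp: TxR_measure_def space_pair_measure space_restrict_space)
  have S: "?S \<in> sets borel" by (intro borel_Times) auto
  have "sets TxR_measure \<subseteq> sets (borel :: (real \<times> real) measure)"
    unfolding TxR_measure_def
    by (rule sets_pair_in_sets) (auto simp: sets_restrict_space_iff intro!: borel_Times)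
  then have Ab: "A \<in> sets borel" using A by auto
  have AS: "A \<subseteq> ?S" using sets.sets_into_space[OF A] sp by simp
  have em: "emeasure TxR_measure X = emeasure lborel X" if X: "X \<in> sets TxR_measure" "X \<in> sets borel" "X \<subseteq> ?S" for X
  proof -
    have "emeasure TxR_measure X = (\<integral>\<^sup>+x. emeasure lborel {t. (x, t) \<in> X} \<partial>restrict_space lborel {0..<1})"
      using lborel.emeasure_pair_measure_alt[of X "restrict_space lborel {0..<1}"] X(1)
      by (simp only: TxR_measure_def vimage_def)
    also have "\<dots> = (\<integral>\<^sup>+x. emeasure lborel {t. (x, t) \<in> X} * indicator {0..<1} x \<partial>lborel)"
      by (rule nn_integral_restrict_space) auto
    also have "\<dots> = (\<integral>\<^sup>+x. emeasure lborel {t. (x, t) \<in> X} \<partial>lborel)"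
    proof (rule nn_integral_cong)
      fix x :: real
      have "{t. (x, t) \<in> X} = {}" if "x \<notin> {0..<1}" using X(3) that by auto
      then show "emeasure lborel {t. (x, t) \<in> X} * indicator {0..<1} x = emeasure lborel {t. (x, t) \<in> X}"
        by (cases "x \<in> {0..<1}") auto
    qed
    finally show ?thesis using emeasure_lborel_sections[OF X(2)] by simp
  qed
  define E where "E = {p. (frac (fst p), snd p) \<in> A}"
  have E: "E \<in> sets borel"
  proof -
    have "(\<lambda>p. (frac (fst p), snd p)) \<in> (borel \<Otimes>\<^sub>M borel) \<rightarrow>\<^sub>M (borel \<Otimes>\<^sub>M borel :: (real \<times> real) measure)"
      unfolding frac_def by measurable
    moreover have "A \<in> sets (borel \<Otimes>\<^sub>M borel)" using Ab by (metis borel_prod)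
    ultimately have "(\<lambda>p. (frac (fst p), snd p)) -` A \<inter> space (borel \<Otimes>\<^sub>M borel) \<in> sets (borel \<Otimes>\<^sub>M borel)"
      by (rule measurable_sets)
    then have "E \<in> sets (borel \<Otimes>\<^sub>M borel)"
      by (simp add: E_def vimage_def space_pair_measure)
    then show ?thesis by (metis borel_prod)
  qed
  have EA: "E \<inter> ?S = A"
  proof -
    have "frac x = x" if "0 \<le> x" "x < 1" for x :: real using that by (simp add: frac_eq)
    then show ?thesis using AS by (force simp: E_def)
  qed
  have "(x + \<alpha>, t + \<phi> x) \<in> E \<longleftrightarrow> (x, t) \<in> E" for x t
  proof -
    have "frac x \<in> {0..<1}" by (simp add: frac_lt_1)
    then have "(frac x, t) \<in> A \<longleftrightarrow> skew_map \<alpha> \<phi> (frac x, t) \<in> A" using inv sp by auto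
    moreover have "frac (frac x + \<alpha>) = frac (x + \<alpha>)"
      by (metis frac_frac frac_add_simps(1))
    moreover have "\<phi> (frac x) = \<phi> x"
      using periodic_of_int[of \<phi> 1 "frac x" "\<lfloor>x\<rfloor>"] \<phi>per by (simp add: frac_def)
    ultimately show ?thesis by (simp add: E_def skew_map_def add.commute)
  qed
  moreover have "(x + 1, t) \<in> E \<longleftrightarrow> (x, t) \<in> E" for x t
    by (simp add: E_def frac_def)
  ultimately have "(AE p in lborel. p \<in> E) \<or> (AE p in lborel. p \<notin> E)"
    by (rule invariant_set_trivial[OF E \<phi> \<open>\<alpha> \<notin> \<rat>\<close>]) (rule approx)
  then have "(AE p in lborel. p \<notin> ?S - A) \<or> (AE p in lborel. p \<notin> A)"
    using EA by (elim disj_forward) (auto elim!: eventually_mono)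
  then have "emeasure lborel (?S - A) = 0 \<or> emeasure lborel A = 0"
    using AE_iff_measurable[of "?S - A" lborel "\<lambda>p. p \<notin> ?S - A"] AE_iff_measurable[of A lborel "\<lambda>p. p \<notin> A"] S Ab
    by auto
  then show "emeasure TxR_measure A = 0 \<or> emeasure TxR_measure (space TxR_measure - A) = 0"
    using em[OF A Ab AS] em[of "?S - A"] sets.compl_sets[OF A] S Ab by (auto simp: sp)
qed

section \<open>Absolutely convergent Fourier series\<close>

definition fourier_null :: "(real \<Rightarrow> complex) \<Rightarrow> bool" where
  "fourier_null g \<longleftrightarrow> integrable lborel g \<and> (\<forall>n::int. (\<integral>x. g x * cis (2 * pi * of_int n * x) \<partial>lborel) = 0)"

lemma borel_measurable_cis_linear [measurable]: "(\<lambda>x. cis (c * x)) \<in> borel_measurable borel"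
  by (intro borel_measurable_continuous_onI continuous_intros)

lemma integrable_mult_bounded:
  fixes g Q :: "real \<Rightarrow> complex"
  assumes "integrable lborel g" and [measurable]: "Q \<in> borel_measurable borel" and "\<And>x. norm (Q x) \<le> B"
  shows "integrable lborel (\<lambda>x. g x * Q x)"
proof (rule Bochner_Integration.integrable_bound)
  show "integrable lborel (\<lambda>x. B *\<^sub>R g x)" using assms(1) by simp
  show "AE x in lborel. norm (g x * Q x) \<le> norm (B *\<^sub>R g x)"
  proof (intro AE_I2)
    fix x
    have "norm (g x) * norm (Q x) \<le> norm (g x) * \<bar>B\<bar>"
      using assms(3)[of x] by (intro mult_left_mono) auto
    then show "norm (g x * Q x) \<le> norm (B *\<^sub>R g x)" by (simp add: norm_mult mult.commute)
  qed
qed (use assms(1) in measurable)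

lemma fourier_null_integrable:
  "fourier_null g \<Longrightarrow> integrable lborel (\<lambda>x. g x * cis (2 * pi * of_int n * x))"
  unfolding fourier_null_def by (auto intro!: integrable_mult_bounded[where B=1])

lemma fourier_null_poly:
  assumes "real_polynomial_function p" "fourier_null g"
  shows "fourier_null (\<lambda>x. g x * of_real (p (cis (2 * pi * x))))"
  using assms
proof (induction arbitrary: g rule: real_polynomial_function.induct)
  case (linear f)
  define A where "A = (of_real (f 1) - \<i> * of_real (f \<i>)) / 2"
  define B where "B = (of_real (f 1) + \<i> * of_real (f \<i>)) / 2"
  have f: "of_real (f (cis t)) = A * cis t + B * cis (- t)" for t
  proof -
    have "cis t = cos t *\<^sub>R 1 + sin t *\<^sub>R \<i>" by (simp add: complex_eq_iff)
    then have "f (cis t) = f (cos t *\<^sub>R 1 + sin t *\<^sub>R \<i>)" by simp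
    also have "\<dots> = cos t * f 1 + sin t * f \<i>"
      by (simp only: linear_add[OF bounded_linear.linear[OF linear(1)]] linear_scale[OF bounded_linear.linear[OF linear(1)]] real_scaleR_def)
    finally show ?thesis by (simp add: A_def B_def complex_eq_iff field_simps)
  qed
  have eq: "g x * of_real (f (cis (2 * pi * x))) * cis (2 * pi * of_int n * x)
    = A * (g x * cis (2 * pi * of_int (n + 1) * x)) + B * (g x * cis (2 * pi * of_int (n - 1) * x))" for n x
  proof -
    have "cis (2 * pi * of_int (n + 1) * x) = cis (2 * pi * x) * cis (2 * pi * of_int n * x)"
      "cis (2 * pi * of_int (n - 1) * x) = cis (- (2 * pi * x)) * cis (2 * pi * of_int n * x)"
      by (simp_all add: cis_mult algebra_simps)
    then show ?thesis by (simp add: f algebra_simps)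
  qed
  have "integrable lborel (\<lambda>x. g x * of_real (f (cis (2 * pi * x))))"
    using eq[of _ 0] fourier_null_integrable[OF linear(2), of 1] fourier_null_integrable[OF linear(2), of "-1"]
    by simp
  moreover have "(\<integral>x. g x * of_real (f (cis (2 * pi * x))) * cis (2 * pi * of_int n * x) \<partial>lborel) = 0" for n
    unfolding eq using fourier_null_integrable[OF linear(2)] linear(2)
    by (subst Bochner_Integration.integral_add) (auto simp: fourier_null_def simp del: of_int_add of_int_diff)
  ultimately show ?case by (simp add: fourier_null_def)
next
  case (const c)
  then show ?case by (auto simp: fourier_null_def mult.assoc mult.left_commute[of _ "of_real c"])
next
  case (add f h)
  note N = add.IH(1)[OF add.prems] add.IH(2)[OF add.prems]
  have "g x * of_real (f (cis (2 * pi * x)) + h (cis (2 * pi * x))) * cis (2 * pi * of_int n * x)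
    = g x * of_real (f (cis (2 * pi * x))) * cis (2 * pi * of_int n * x)
      + g x * of_real (h (cis (2 * pi * x))) * cis (2 * pi * of_int n * x)" for n x
    by (simp add: algebra_simps)
  moreover have "integrable lborel (\<lambda>x. g x * of_real (f (cis (2 * pi * x)) + h (cis (2 * pi * x))))"
    using N by (simp add: fourier_null_def distrib_left)
  ultimately show ?case
    using N fourier_null_integrable[OF N(1)] fourier_null_integrable[OF N(2)] by (simp add: fourier_null_def)
next
  case (mult f h)
  show ?case using mult.IH(2)[OF mult.IH(1)[OF mult.prems]] by (simp add: mult.assoc)
qed

lemma fourier_null_continuous:
  fixes k :: "complex \<Rightarrow> real"
  assumes g: "fourier_null g" and k: "continuous_on UNIV k"
  shows "(\<integral>x. g x * of_real (k (cis (2 * pi * x))) \<partial>lborel) = 0"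
proof -
  have gi: "integrable lborel g" using g by (simp add: fourier_null_def)
  have km: "(\<lambda>x. complex_of_real (k (cis (2 * pi * x)))) \<in> borel_measurable borel"
    by (intro borel_measurable_continuous_onI continuous_intros continuous_on_compose2[OF k]) auto
  have "norm (\<integral>x. g x * of_real (k (cis (2 * pi * x))) \<partial>lborel) \<le> 0 + e" if "e > 0" for e
  proof -
    define I where "I = (\<integral>x. norm (g x) \<partial>lborel)"
    have "I \<ge> 0" by (simp add: I_def)
    define e' where "e' = e / (I + 1)"
    have e': "e' > 0" using \<open>e > 0\<close> \<open>I \<ge> 0\<close> by (simp add: e'_def)
    obtain p where p: "real_polynomial_function p" "\<And>z. z \<in> sphere 0 1 \<Longrightarrow> \<bar>k z - p z\<bar> < e'"
      using Stone_Weierstrass_real_polynomial_function[of "sphere 0 1" k e'] e' k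
      by (metis compact_sphere continuous_on_subset subset_UNIV)
    have d: "norm (complex_of_real (k (cis t)) - of_real (p (cis t))) \<le> e'" for t
      using p(2)[of "cis t"] by (simp flip: of_real_diff)
    have P: "fourier_null (\<lambda>x. g x * of_real (p (cis (2 * pi * x))))" by (rule fourier_null_poly[OF p(1) g])
    then have Pi: "integrable lborel (\<lambda>x. g x * of_real (p (cis (2 * pi * x))))"
      and P0: "(\<integral>x. g x * of_real (p (cis (2 * pi * x))) \<partial>lborel) = 0"
      unfolding fourier_null_def by (auto dest: spec[of _ 0])
    have "compact (k ` sphere 0 1)"
      by (rule compact_continuous_image) (use k continuous_on_subset in auto)
    then obtain B where "\<And>z. z \<in> sphere 0 1 \<Longrightarrow> norm (k z) \<le> B"
      using compact_imp_bounded bounded_iff by (metis imageI)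
    then have Ki: "integrable lborel (\<lambda>x. g x * of_real (k (cis (2 * pi * x))))"
      by (intro integrable_mult_bounded[OF gi km, of B]) auto
    have "norm (\<integral>x. g x * of_real (k (cis (2 * pi * x))) \<partial>lborel)
        = norm (\<integral>x. g x * of_real (k (cis (2 * pi * x))) - g x * of_real (p (cis (2 * pi * x))) \<partial>lborel)"
      using P0 Ki Pi by simp
    also have "\<dots> \<le> (\<integral>x. norm (g x) * e' \<partial>lborel)"
    proof (rule Bochner_Integration.integral_norm_bound_integral)
      show "norm (g x * of_real (k (cis (2 * pi * x))) - g x * of_real (p (cis (2 * pi * x)))) \<le> norm (g x) * e'" for x
        using d[of "2 * pi * x"] by (simp add: norm_mult mult_left_mono flip: right_diff_distrib)
    qed (use Ki Pi gi in auto)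
    also have "\<dots> = I * e'" by (simp add: I_def)
    also have "\<dots> \<le> e" using \<open>I \<ge> 0\<close> \<open>e > 0\<close> by (simp add: e'_def field_simps)
    finally show ?thesis by simp
  qed
  then have "norm (\<integral>x. g x * of_real (k (cis (2 * pi * x))) \<partial>lborel) \<le> 0"
    by (rule field_le_epsilon)
  then show ?thesis by simp
qed

lemma fourier_null_open:
  assumes g: "fourier_null g" and U: "open U"
  shows "(\<integral>x. g x * indicator U (cis (2 * pi * x)) \<partial>lborel) = 0"
proof (cases "U = UNIV")
  case True
  then show ?thesis using fourier_null_continuous[OF g, of "\<lambda>_. 1"] by simp
next
  case False
  have gi: "integrable lborel g" using g by (simp add: fourier_null_def)
  define k where "k = (\<lambda>(j::nat) z. min 1 (real j * infdist z (- U)))"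
  have kc: "continuous_on UNIV (k j)" for j
    unfolding k_def by (intro continuous_intros)
  have lim: "(\<lambda>j. k j z) \<longlonglongrightarrow> indicator U z" for z
  proof (cases "z \<in> U")
    case True
    then have pos: "infdist z (- U) > 0"
      using in_closed_iff_infdist_zero[of "- U" z] U False infdist_nonneg[of z "- U"] by (force simp: closed_Compl)
    have "\<forall>\<^sub>F j in sequentially. k j z = 1"
    proof -
      obtain N where N: "1 / infdist z (- U) \<le> real N" using real_arch_simple by blast
      show ?thesis unfolding eventually_sequentially
      proof (intro exI allI impI)
        fix j assume "N \<le> j"
        then have "1 / infdist z (- U) \<le> real j" using N by linarith
        then show "k j z = 1" using pos by (simp add: k_def field_simps min_def)
      qed
    qed
    then show ?thesis using True by (simp add: tendsto_eventually)
  next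
    case False
    then show ?thesis by (simp add: k_def)
  qed
  have "(\<lambda>j. \<integral>x. g x * of_real (k j (cis (2 * pi * x))) \<partial>lborel) \<longlonglongrightarrow> (\<integral>x. g x * of_real (indicator U (cis (2 * pi * x))) \<partial>lborel)"
  proof (rule integral_dominated_convergence[where w="\<lambda>x. norm (g x)"])
    have [measurable]: "U \<in> sets borel" "g \<in> borel_measurable borel" using U gi by auto
    show "(\<lambda>x. g x * of_real (indicator U (cis (2 * pi * x)))) \<in> borel_measurable lborel" by measurable
    have [measurable]: "k j \<in> borel_measurable borel" for j
      by (rule borel_measurable_continuous_onI[OF kc])
    show "(\<lambda>x. g x * of_real (k j (cis (2 * pi * x)))) \<in> borel_measurable lborel" for j by measurable
    show "AE x in lborel. (\<lambda>j. g x * of_real (k j (cis (2 * pi * x)))) \<longlonglongrightarrow> g x * of_real (indicator U (cis (2 * pi * x)))"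
      by (intro AE_I2 tendsto_intros lim)
    have "\<bar>k j z\<bar> \<le> 1" for j z by (simp add: k_def infdist_nonneg)
    then show "AE x in lborel. norm (g x * of_real (k j (cis (2 * pi * x)))) \<le> norm (g x)" for j
      by (intro AE_I2) (simp add: norm_mult mult_left_le)
  qed (use gi in auto)
  moreover have "complex_of_real (indicator U z) = indicator U z" for z by (simp add: indicator_def)
  ultimately show ?thesis
    using fourier_null_continuous[OF g kc] by (simp add: LIMSEQ_const_iff)
qed

lemma fourier_null_imp_AE_zero:
  assumes g: "fourier_null g" and supp: "\<And>x. x \<notin> {0..1} \<Longrightarrow> g x = 0"
  shows "AE x in lborel. g x = 0"
proof (rule sigma_finite_measure.density_zero[OF lborel.sigma_finite_measure_axioms])
  show gi: "integrable lborel g" using g by (simp add: fourier_null_def)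
  have all: "(\<integral>x. g x \<partial>lborel) = 0"
    using g unfolding fourier_null_def by (auto dest: spec[of _ 0])
  have half: "set_lebesgue_integral lborel {..<a} g = 0" for a
  proof -
    consider "a \<le> 0" | "0 < a" "a \<le> 1" | "1 < a" by linarith
    then show ?thesis
    proof cases
      case 1
      then have "(\<lambda>x. indicat_real {..<a} x *\<^sub>R g x) = (\<lambda>_. 0)"
        using supp by (fastforce simp: indicator_def)
      then show ?thesis by (simp only: set_lebesgue_integral_def Bochner_Integration.integral_zero)
    next
      case 3
      then have "(\<lambda>x. indicat_real {..<a} x *\<^sub>R g x) = g"
        using supp by (fastforce simp: indicator_def)
      then show ?thesis using all by (simp only: set_lebesgue_integral_def)
    next
      case 2
      define U where "U = {z. 0 < Arg2pi z} \<inter> {z. Arg2pi z < 2 * pi * a}"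
      have "open U"
        using open_Arg2pi2pi_less_Int[of 0 "2 * pi * a"] 2 by (simp add: U_def)
      have Uiff: "cis (2 * pi * x) \<in> U \<longleftrightarrow> x < a" if "0 < x" "x < 1" for x
      proof -
        have "Arg2pi (cis (2 * pi * x)) = 2 * pi * x"
          by (rule Arg2pi_unique[of 1]) (use that in \<open>auto simp: cis_conv_exp\<close>)
        then show ?thesis using that by (simp add: U_def)
      qed
      have [measurable]: "U \<in> sets borel" "g \<in> borel_measurable borel" using \<open>open U\<close> gi by auto
      have "AE x in lborel. x \<notin> {0, 1 :: real}"
        by (intro AE_not_in) (auto intro: finite_imp_null_set_lborel)
      then have "AE x in lborel. indicator {..<a} x *\<^sub>R g x = g x * indicator U (cis (2 * pi * x))"
      proof eventually_elim
        case (elim x)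
        then show ?case using Uiff[of x] supp[of x] by (cases "0 < x \<and> x < 1") (auto simp: indicator_def)
      qed
      then have "(\<integral>x. indicator {..<a} x *\<^sub>R g x \<partial>lborel) = (\<integral>x. g x * indicator U (cis (2 * pi * x)) \<partial>lborel)"
        by (intro integral_cong_AE) measurable
      then show ?thesis using fourier_null_open[OF g \<open>open U\<close>] by (simp add: set_lebesgue_integral_def)
    qed
  qed
  have si: "set_integrable lborel A g" if "A \<in> sets borel" for A
    unfolding set_integrable_def by (rule integrable_mult_indicator) (use that gi in auto)
  fix A :: "real set" assume "A \<in> sets lborel"
  then have A: "A \<in> sigma_sets UNIV (range (\<lambda>a::real. {..<a}))"
    by (simp add: borel_eq_lessThan eucl_lessThan)
  have sb: "sigma_sets UNIV (range (\<lambda>a::real. {..<a})) = sets borel"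
    by (simp add: borel_eq_lessThan eucl_lessThan)
  have "{..<a} \<inter> {..<b} = {..<min a b}" for a b :: real by auto
  then have "Int_stable (range (\<lambda>a::real. {..<a}))" by (auto simp: Int_stable_def)
  moreover have "range (\<lambda>a::real. {..<a}) \<subseteq> Pow UNIV" by simp
  ultimately show "set_lebesgue_integral lborel A g = 0" using A
  proof (induction rule: sigma_sets_induct_disjoint)
    case empty
    then show ?case by (simp add: set_lebesgue_integral_def)
  next
    case (compl A)
    have "set_lebesgue_integral lborel UNIV g = set_lebesgue_integral lborel (UNIV - A) g + set_lebesgue_integral lborel A g"
      using compl(1) si by (subst set_integral_Un[symmetric]) (auto simp: sb intro!: si)
    then show ?case using compl(2) all by (simp add: set_lebesgue_integral_def)
  next
    case (union A)
    have "(\<Union>i. A i) \<in> sets borel" using union(2) unfolding sb by auto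
    then have "set_lebesgue_integral lborel (\<Union>i. A i) g = (\<Sum>i. set_lebesgue_integral lborel (A i) g)"
      using union by (intro lebesgue_integral_countable_add si) (auto simp: sb disjoint_family_on_def)
    then show ?case using union(3) by simp
  qed (use half in auto)
qed

lemma integral_lebesgue_on_conv_lborel:
  fixes F :: "real \<Rightarrow> 'b :: {banach, second_countable_topology}"
  assumes [measurable]: "F \<in> borel_measurable borel" "S \<in> sets borel"
  shows "integral\<^sup>L (lebesgue_on S) F = (\<integral>x. indicator S x *\<^sub>R F x \<partial>lborel)"
    and "integrable (lebesgue_on S) F \<longleftrightarrow> integrable lborel (\<lambda>x. indicator S x *\<^sub>R F x)"
  by (simp_all add: integral_restrict_space integrable_restrict_space integral_completion integrable_completion)

definition fourier_series :: "(int \<Rightarrow> complex) \<Rightarrow> real \<Rightarrow> complex" where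
  "fourier_series c x = (\<Sum>\<^sub>\<infinity>n. c n * cis (2 * pi * of_int n * x))"

lemma fourier_series_uniform_limit:
  assumes "(\<lambda>n. norm (c n)) summable_on UNIV"
  shows "uniform_limit UNIV (\<lambda>N x. \<Sum>n\<in>N. c n * cis (2 * pi * of_int n * x)) (fourier_series c) (finite_subsets_at_top UNIV)"
  unfolding fourier_series_def
  by (rule Weierstrass_m_test_general[OF _ assms]) (simp add: norm_mult)

lemma fourier_series_summable:
  assumes "(\<lambda>n. norm (c n)) summable_on UNIV"
  shows "(\<lambda>n. c n * cis (2 * pi * of_int n * x)) summable_on UNIV"
  by (rule abs_summable_summable) (use assms in \<open>simp add: norm_mult\<close>)

lemma continuous_fourier_series:
  assumes "(\<lambda>n. norm (c n)) summable_on UNIV"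
  shows "continuous_on UNIV (fourier_series c)"
  by (rule uniform_limit_theorem[OF _ fourier_series_uniform_limit[OF assms]])
    (auto intro!: always_eventually continuous_intros)

lemma cis_2pi_of_int: "cis (2 * pi * of_int k) = 1"
  by (simp add: cis_multiple_2pi)

lemma fourier_series_periodic: "fourier_series c (x + 1) = fourier_series c x"
proof -
  have "cis (2 * pi * of_int n * (x + 1)) = cis (2 * pi * of_int n * x)" for n :: int
    using cis_2pi_of_int[of n] by (simp add: distrib_left flip: cis_mult)
  then show ?thesis by (simp add: fourier_series_def)
qed

lemma integral_exponential_period:
  fixes k :: int
  shows "(\<integral>x. indicator {0..1} x *\<^sub>R cis (2 * pi * of_int k * x) \<partial>lborel) = (if k = 0 then 1 else 0)"
proof -
  let ?F = "\<lambda>x::real. if k = 0 then complex_of_real x else cis (2 * pi * of_int k * x) / (2 * pi * of_int k * \<i>)"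
  have d: "(?F has_vector_derivative cis (2 * pi * of_int k * x)) (at x within {0..1})" for x
  proof (cases "k = 0")
    case True
    then show ?thesis by (auto intro!: derivative_eq_intros simp: has_vector_derivative_def fun_eq_iff scaleR_conv_of_real)
  next
    case False
    have "((\<lambda>x. cis (2 * pi * of_int k * x) / (2 * pi * of_int k * \<i>)) has_vector_derivative
        ((2 * pi * of_int k) *\<^sub>R (\<i> * cis (2 * pi * of_int k * x))) / (2 * pi * of_int k * \<i>)) (at x within {0..1})"
      by (auto intro!: derivative_eq_intros simp: has_vector_derivative_def scaleR_conv_of_real fun_eq_iff complex_eq_iff)
    then show ?thesis using False by (simp add: scaleR_conv_of_real)
  qed
  have "((\<lambda>x. cis (2 * pi * of_int k * x)) has_integral (?F 1 - ?F 0)) {0..1}"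
    by (rule fundamental_theorem_of_calculus) (use d in auto)
  moreover have "?F 1 - ?F 0 = (if k = 0 then 1 else 0)"
    using cis_2pi_of_int[of k] by simp
  moreover have "set_integrable lborel {0..1} (\<lambda>x. cis (2 * pi * of_int k * x))"
    by (intro borel_integrable_atLeastAtMost' continuous_intros)
  ultimately show ?thesis
    using set_borel_integral_eq_integral(2)[of "{0..1}" "\<lambda>x. cis (2 * pi * of_int k * x)"]
    by (simp add: set_lebesgue_integral_def integral_unique)
qed

lemma integral_fourier_series:
  assumes c: "(\<lambda>n. norm (c n)) summable_on UNIV"
  shows "(\<integral>x. indicator {0..1} x *\<^sub>R (fourier_series c x * cis (- 2 * pi * of_int k * x)) \<partial>lborel) = c k"
proof -
  let ?e = "\<lambda>n::int. \<lambda>x. cis (2 * pi * of_int n * x)"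
  have [measurable]: "fourier_series c \<in> borel_measurable borel"
    by (rule borel_measurable_continuous_onI[OF continuous_fourier_series[OF c]])
  have int: "integrable lborel (\<lambda>x. indicator {0..1 :: real} x *\<^sub>R Q x)"
    if "continuous_on UNIV Q" for Q :: "real \<Rightarrow> complex"
    using borel_integrable_atLeastAtMost'[of 0 1 Q] continuous_on_subset[OF that]
    by (auto simp: set_integrable_def)
  let ?I = "\<lambda>Q. \<integral>x. indicator {0..1 :: real} x *\<^sub>R Q x \<partial>lborel"
  have "norm (?I (\<lambda>x. fourier_series c x * cis (- 2 * pi * of_int k * x)) - c k) \<le> 0 + e" if "e > 0" for e
  proof -
    have "\<forall>\<^sub>F N in finite_subsets_at_top UNIV. \<forall>x\<in>UNIV. dist (\<Sum>n\<in>N. c n * ?e n x) (fourier_series c x) < e"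
      using uniform_limitD[OF fourier_series_uniform_limit[OF c] \<open>e > 0\<close>] .
    moreover have "\<forall>\<^sub>F N in finite_subsets_at_top UNIV. finite N \<and> {k} \<subseteq> N"
      using eventually_finite_subsets_at_top_finite[of UNIV "finite"]
      by (auto simp: eventually_finite_subsets_at_top intro!: exI[of _ "{k}"])
    ultimately have "\<forall>\<^sub>F N in finite_subsets_at_top (UNIV :: int set).
        (\<forall>x. dist (\<Sum>n\<in>N. c n * ?e n x) (fourier_series c x) < e) \<and> finite N \<and> {k} \<subseteq> N"
      by eventually_elim simp
    then obtain N where N: "\<And>x. dist (\<Sum>n\<in>N. c n * ?e n x) (fourier_series c x) < e" "finite N" "k \<in> N"
      by (auto dest!: eventually_happens)
    have prod: "?e n x * cis (- 2 * pi * of_int k * x) = ?e (n - k) x" for n x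
      by (simp add: cis_mult algebra_simps)
    have "(\<Sum>n\<in>N. c n * ?e n x) * cis (- 2 * pi * of_int k * x) = (\<Sum>n\<in>N. c n * ?e (n - k) x)" for x
      unfolding sum_distrib_right by (rule sum.cong[OF refl]) (metis mult.assoc prod)
    then have "?I (\<lambda>x. (\<Sum>n\<in>N. c n * ?e n x) * cis (- 2 * pi * of_int k * x))
        = ?I (\<lambda>x. \<Sum>n\<in>N. c n * ?e (n - k) x)"
      by simp
    also have "\<dots> = (\<Sum>n\<in>N. c n * ?I (?e (n - k)))"
    proof -
      have "integrable lborel (\<lambda>x. indicator {0..1 :: real} x *\<^sub>R ?e (n - k) x)" for n
        by (intro int continuous_intros)
      then show ?thesis
        by (simp add: scaleR_sum_right mult_scaleR_right[symmetric] del: mult_scaleR_right)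
    qed
    also have "\<dots> = c k"
      using N(2,3) by (simp add: integral_exponential_period if_distrib del: of_int_diff cong: if_cong)
    finally have ck: "?I (\<lambda>x. (\<Sum>n\<in>N. c n * ?e n x) * cis (- 2 * pi * of_int k * x)) = c k" .
    have i1: "integrable lborel (\<lambda>x. indicator {0..1 :: real} x *\<^sub>R (fourier_series c x * cis (- 2 * pi * of_int k * x)))"
      by (intro int continuous_intros continuous_fourier_series c)
    have i2: "integrable lborel (\<lambda>x. indicator {0..1 :: real} x *\<^sub>R ((\<Sum>n\<in>N. c n * ?e n x) * cis (- 2 * pi * of_int k * x)))"
      by (intro int continuous_intros)
    have "norm (?I (\<lambda>x. fourier_series c x * cis (- 2 * pi * of_int k * x)) - c k)
      = norm (\<integral>x. indicator {0..1 :: real} x *\<^sub>R (fourier_series c x * cis (- 2 * pi * of_int k * x))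
          - indicator {0..1 :: real} x *\<^sub>R ((\<Sum>n\<in>N. c n * ?e n x) * cis (- 2 * pi * of_int k * x)) \<partial>lborel)"
      unfolding ck[symmetric] using i1 i2 by simp
    also have "\<dots> \<le> (\<integral>x. indicator {0..1 :: real} x *\<^sub>R e \<partial>lborel)"
    proof (rule Bochner_Integration.integral_norm_bound_integral)
      fix x :: real
      have "norm (fourier_series c x * cis (- 2 * pi * of_int k * x) - (\<Sum>n\<in>N. c n * ?e n x) * cis (- 2 * pi * of_int k * x)) \<le> e"
        using N(1)[of x] by (simp add: dist_norm norm_minus_commute norm_mult flip: left_diff_distrib)
      then show "norm (indicator {0..1 :: real} x *\<^sub>R (fourier_series c x * cis (- 2 * pi * of_int k * x))
          - indicator {0..1 :: real} x *\<^sub>R ((\<Sum>n\<in>N. c n * ?e n x) * cis (- 2 * pi * of_int k * x)))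
        \<le> indicator {0..1 :: real} x *\<^sub>R e"
        by (auto simp: indicator_def)
    qed (use i1 i2 in \<open>auto intro!: integrable_mult_indicator\<close>)
    also have "\<dots> = e" by simp
    finally show ?thesis by simp
  qed
  then have "norm (?I (\<lambda>x. fourier_series c x * cis (- 2 * pi * of_int k * x)) - c k) \<le> 0"
    by (rule field_le_epsilon)
  then show ?thesis by simp
qed

lemma AE_periodic:
  fixes P :: "real \<Rightarrow> bool"
  assumes [measurable]: "Measurable.pred borel P" and per: "\<And>x. P (x + 1) = P x"
    and ae: "AE x in lborel. x \<in> {0..1} \<longrightarrow> P x"
  shows "AE x in lborel. P x"
proof -
  have "AE x in lborel. - of_int n + 1 * x \<in> {0..1} \<longrightarrow> P (- of_int n + 1 * x)" for n :: int
    by (rule AE_borel_affine[where P="\<lambda>x. x \<in> {0..1} \<longrightarrow> P x"]) (use ae in auto)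
  then have "AE x in lborel. \<forall>n::int. - of_int n + 1 * x \<in> {0..1} \<longrightarrow> P (- of_int n + 1 * x)"
    by (simp add: AE_all_countable)
  then show ?thesis
  proof eventually_elim
    case (elim x)
    have "frac x \<in> {0..1}" by (simp add: frac_lt_1 less_imp_le)
    then have "P (frac x)" using elim[rule_format, of "\<lfloor>x\<rfloor>"] by (simp add: frac_def)
    then show ?case
      using periodic_of_int[of P 1 "frac x" "\<lfloor>x\<rfloor>"] per by (simp add: frac_def)
  qed
qed

lemma periodic_eq_AE_fourier_series:
  fixes f :: "real \<Rightarrow> real"
  assumes f [measurable]: "f \<in> borel_measurable borel" and per: "\<And>x. f (x + 1) = f x"
    and int: "integrable (lebesgue_on {0..1}) f"
    and c: "(\<lambda>n. norm (fourier_coeff f n)) summable_on UNIV"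
  shows "AE x in lborel. f x = Re (fourier_series (fourier_coeff f) x)"
proof -
  let ?G = "fourier_series (fourier_coeff f)"
  have [measurable]: "?G \<in> borel_measurable borel"
    by (rule borel_measurable_continuous_onI[OF continuous_fourier_series[OF c]])
  define H where "H = (\<lambda>x. indicator {0..1} x *\<^sub>R (complex_of_real (f x) - ?G x))"
  have fi: "integrable lborel (\<lambda>x. complex_of_real (indicator {0..1} x *\<^sub>R f x))"
    using int by (subst (asm) integral_lebesgue_on_conv_lborel(2)) (auto intro: integrable_of_real simp del: of_real_mult)
  then have fi: "integrable lborel (\<lambda>x. indicator {0..1} x *\<^sub>R complex_of_real (f x))"
    by (simp add: scaleR_conv_of_real)
  have Gi: "integrable lborel (\<lambda>x. indicator {0..1} x *\<^sub>R ?G x)"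
    using borel_integrable_atLeastAtMost'[of 0 1 ?G] continuous_on_subset[OF continuous_fourier_series[OF c]]
    by (auto simp: set_integrable_def)
  have Hi: "integrable lborel H"
    unfolding H_def scaleR_diff_right by (intro Bochner_Integration.integrable_diff fi Gi)
  have "(\<integral>x. H x * cis (2 * pi * of_int n * x) \<partial>lborel) = 0" for n
  proof -
    let ?e = "\<lambda>x. cis (- 2 * pi * of_int (- n) * x)"
    have e: "cis (2 * pi * of_int n * x) = ?e x" for x by simp
    have "(\<integral>x. H x * cis (2 * pi * of_int n * x) \<partial>lborel)
      = (\<integral>x. indicator {0..1} x *\<^sub>R (complex_of_real (f x)) * ?e x - indicator {0..1} x *\<^sub>R (?G x) * ?e x \<partial>lborel)"
      unfolding e H_def by (intro Bochner_Integration.integral_cong) (simp_all add: algebra_simps)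
    also have "\<dots> = (\<integral>x. indicator {0..1} x *\<^sub>R complex_of_real (f x) * ?e x \<partial>lborel)
        - (\<integral>x. indicator {0..1} x *\<^sub>R ?G x * ?e x \<partial>lborel)"
      by (intro Bochner_Integration.integral_diff integrable_mult_bounded[where B=1] fi Gi) simp_all
    also have "(\<integral>x. indicator {0..1} x *\<^sub>R complex_of_real (f x) * ?e x \<partial>lborel) = fourier_coeff f (- n)"
      unfolding fourier_coeff_def by (subst integral_lebesgue_on_conv_lborel(1)) auto
    also have "(\<integral>x. indicator {0..1} x *\<^sub>R ?G x * ?e x \<partial>lborel) = fourier_coeff f (- n)"
      using integral_fourier_series[OF c, of "- n"] by simp
    finally show ?thesis by simp
  qed
  then have "fourier_null H" using Hi by (simp add: fourier_null_def)
  then have "AE x in lborel. H x = 0"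
    by (rule fourier_null_imp_AE_zero) (simp add: H_def)
  then have "AE x in lborel. x \<in> {0..1} \<longrightarrow> f x = Re (?G x)"
    by eventually_elim (auto simp: H_def complex_eq_iff)
  then show ?thesis
    by (intro AE_periodic[where P="\<lambda>x. f x = Re (?G x)"]) (simp_all add: per fourier_series_periodic)
qed

lemma sum_roots_of_unity:
  fixes n :: int and q :: nat
  assumes "q > 0"
  shows "(\<Sum>j<q. cis (2 * pi * of_int n * (real j / real q))) = (if int q dvd n then of_nat q else 0)"
proof -
  define z where "z = cis (2 * pi * of_int n / real q)"
  have pow: "cis (2 * pi * of_int n * (real j / real q)) = z ^ j" for j
  proof -
    have "2 * pi * of_int n * (real j / real q) = real j * (2 * pi * of_int n / real q)" by simp
    then show ?thesis by (simp only: z_def Complex.DeMoivre)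
  qed
  show ?thesis
  proof (cases "int q dvd n")
    case True
    then obtain k where "n = int q * k" by blast
    then have "2 * pi * of_int n / real q = 2 * pi * of_int k" using assms by simp
    then have "z = 1" by (simp only: z_def cis_2pi_of_int)
    then show ?thesis using True unfolding pow by simp
  next
    case False
    have "z \<noteq> 1"
    proof
      assume "z = 1"
      then have "cos (2 * pi * of_int n / real q) = 1" by (simp add: z_def complex_eq_iff)
      then obtain k :: int where "2 * pi * of_int n / real q = of_int k * 2 * pi"
        unfolding cos_one_2pi_int by blast
      then have "of_int n = real_of_int (k * int q)" using assms by (simp add: field_simps)
      then show False using False by (metis dvd_triv_right of_int_eq_iff)
    qed
    moreover have "z ^ q = 1"
    proof -
      have "real q * (2 * pi * of_int n / real q) = 2 * pi * of_int n" using assms by simp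
      then show ?thesis by (simp only: z_def Complex.DeMoivre cis_2pi_of_int)
    qed
    ultimately show ?thesis using False unfolding pow by (simp add: geometric_sum)
  qed
qed

lemma has_sum_sum:
  fixes F :: "'i \<Rightarrow> 'a \<Rightarrow> complex"
  assumes "finite J" "\<And>j. j \<in> J \<Longrightarrow> (F j has_sum S j) A"
  shows "((\<lambda>n. \<Sum>j\<in>J. F j n) has_sum (\<Sum>j\<in>J. S j)) A"
  using assms by (induction J rule: finite_induct) (auto intro: has_sum_add)

lemma norm_fold_fourier_series_le:
  assumes c: "(\<lambda>n. norm (c n)) summable_on UNIV" and "q > 0"
  shows "norm (\<Sum>j<q. fourier_series c (x + real j / real q)) \<le> real q * (\<Sum>\<^sub>\<infinity>l. norm (c (l * int q)))"
proof -
  let ?e = "\<lambda>n::int. cis (2 * pi * of_int n * x)"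
  have inj: "inj (\<lambda>l. l * int q)" using assms(2) by (auto intro: injI)
  have sm: "(\<lambda>l. norm (c (l * int q))) summable_on UNIV"
  proof -
    have "(\<lambda>n. norm (c n)) summable_on range (\<lambda>l. l * int q)"
      by (rule summable_on_subset_banach[OF c]) simp
    then show ?thesis using summable_on_reindex[OF inj, of "\<lambda>n. norm (c n)"] by (simp add: o_def)
  qed
  have "(\<Sum>j<q. fourier_series c (x + real j / real q))
      = (\<Sum>j<q. \<Sum>\<^sub>\<infinity>n. c n * cis (2 * pi * of_int n * (x + real j / real q)))"
    by (simp add: fourier_series_def)
  also have "\<dots> = (\<Sum>\<^sub>\<infinity>n. \<Sum>j<q. c n * cis (2 * pi * of_int n * (x + real j / real q)))"
    by (rule infsumI[symmetric], rule has_sum_sum)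
      (auto intro: has_sum_infsum fourier_series_summable[OF c])
  also have "\<dots> = (\<Sum>\<^sub>\<infinity>n. c n * ?e n * (if int q dvd n then of_nat q else 0))"
  proof (rule infsum_cong)
    fix n
    have "cis (2 * pi * of_int n * (x + real j / real q)) = ?e n * cis (2 * pi * of_int n * (real j / real q))" for j
      by (simp only: distrib_left cis_mult)
    then show "(\<Sum>j<q. c n * cis (2 * pi * of_int n * (x + real j / real q))) = c n * ?e n * (if int q dvd n then of_nat q else 0)"
      using sum_roots_of_unity[OF assms(2), of n] by (simp only: sum_distrib_left[symmetric] mult.assoc)
  qed
  also have "\<dots> = (\<Sum>\<^sub>\<infinity>n\<in>range (\<lambda>l. l * int q). c n * ?e n * of_nat q)"
    by (rule infsum_cong_neutral) (auto simp: dvd_def mult.commute)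
  also have "\<dots> = (\<Sum>\<^sub>\<infinity>l. c (l * int q) * ?e (l * int q) * of_nat q)"
    by (subst infsum_reindex[OF inj]) (simp add: o_def)
  finally have "norm (\<Sum>j<q. fourier_series c (x + real j / real q))
     = norm (\<Sum>\<^sub>\<infinity>l. c (l * int q) * ?e (l * int q) * of_nat q)" by simp
  also have "\<dots> \<le> (\<Sum>\<^sub>\<infinity>l. norm (c (l * int q) * ?e (l * int q) * of_nat q))"
    by (rule norm_infsum_bound) (use sm in \<open>simp add: norm_mult summable_on_cmult_left\<close>)
  also have "\<dots> = real q * (\<Sum>\<^sub>\<infinity>l. norm (c (l * int q)))"
    by (simp add: norm_mult infsum_cmult_right' mult.commute)
  finally show ?thesis .
qed

section \<open>Fractions with a large denominator\<close>

definition unsieved :: "nat set \<Rightarrow> real \<Rightarrow> real \<Rightarrow> int set" where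
  "unsieved S a b = {n. a < of_int n \<and> of_int n \<le> b \<and> (\<forall>p\<in>S. \<not> int p dvd n)}"

lemma finite_unsieved: "finite (unsieved S a b)"
proof (rule finite_subset)
  show "unsieved S a b \<subseteq> {\<lfloor>a\<rfloor>..\<lceil>b\<rceil>}"
    by (auto simp: unsieved_def) linarith+
qed simp

lemma card_unsieved_empty:
  assumes "a \<le> b"
  shows "\<bar>real (card (unsieved {} a b)) - (b - a)\<bar> \<le> 1"
proof -
  have "unsieved {} a b = {\<lfloor>a\<rfloor><..\<lfloor>b\<rfloor>}"
    by (auto simp: unsieved_def le_floor_iff floor_less_iff)
  then have "card (unsieved {} a b) = nat (\<lfloor>b\<rfloor> - \<lfloor>a\<rfloor>)" by simp
  moreover have "\<lfloor>a\<rfloor> \<le> \<lfloor>b\<rfloor>" using assms by (rule floor_mono)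
  ultimately show ?thesis by simp linarith
qed

text \<open>Sieving out the multiples of one more prime \<open>p\<close> removes as many numbers as there are unsieved ones in
  the interval shrunk by the factor \<open>p\<close>, so the error at most doubles.\<close>

lemma card_unsieved:
  assumes "finite S" "\<And>p. p \<in> S \<Longrightarrow> prime p" "a \<le> b"
  shows "\<bar>real (card (unsieved S a b)) - (b - a) * (\<Prod>p\<in>S. 1 - 1 / real p)\<bar> \<le> 2 ^ card S"
  using assms
proof (induction S arbitrary: a b rule: finite_induct)
  case empty
  then show ?case using card_unsieved_empty by simp
next
  case (insert p S)
  have p: "prime p" "p > 0" using insert by (auto simp: prime_gt_0_nat)
  let ?P = "\<Prod>p\<in>S. 1 - 1 / real p"
  have "(\<lambda>n. int p * n) ` unsieved S (a / p) (b / p) = unsieved S a b - unsieved (insert p S) a b"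
  proof (intro equalityI subsetI)
    fix m assume "m \<in> (\<lambda>n. int p * n) ` unsieved S (a / p) (b / p)"
    then obtain n where n: "m = int p * n" "n \<in> unsieved S (a / p) (b / p)" by blast
    have "\<not> int s dvd int p * n" if "s \<in> S" for s
    proof -
      have "prime s" "s \<noteq> p" using insert that by auto
      then have "coprime (int s) (int p)" using p by (simp add: primes_coprime)
      then show ?thesis using n(2) that by (auto simp: unsieved_def coprime_dvd_mult_right_iff)
    qed
    then show "m \<in> unsieved S a b - unsieved (insert p S) a b"
      using n p by (auto simp: unsieved_def field_simps)
  next
    fix m assume m: "m \<in> unsieved S a b - unsieved (insert p S) a b"
    then have "int p dvd m" by (auto simp: unsieved_def)
    then obtain n where n: "m = int p * n" by blast
    then have "n \<in> unsieved S (a / p) (b / p)" using m p by (auto simp: unsieved_def field_simps)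
    then show "m \<in> (\<lambda>n. int p * n) ` unsieved S (a / p) (b / p)" using n by blast
  qed
  moreover have "inj_on (\<lambda>n. int p * n) (unsieved S (a / p) (b / p))" using p by (auto intro: inj_onI)
  ultimately have "card (unsieved S (a / p) (b / p)) = card (unsieved S a b - unsieved (insert p S) a b)"
    by (metis card_image)
  also have "\<dots> = card (unsieved S a b) - card (unsieved (insert p S) a b)"
    by (rule card_Diff_subset[OF finite_unsieved]) (auto simp: unsieved_def)
  moreover have "card (unsieved (insert p S) a b) \<le> card (unsieved S a b)"
    by (rule card_mono[OF finite_unsieved]) (auto simp: unsieved_def)
  ultimately have split: "real (card (unsieved (insert p S) a b))
      = real (card (unsieved S a b)) - real (card (unsieved S (a / p) (b / p)))" by simp
  have "\<bar>real (card (unsieved S a b)) - (b - a) * ?P\<bar> \<le> 2 ^ card S"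
    "\<bar>real (card (unsieved S (a / p) (b / p))) - (b / p - a / p) * ?P\<bar> \<le> 2 ^ card S"
    using insert p by (auto intro!: insert.IH divide_right_mono)
  moreover have "(b - a) * (\<Prod>p\<in>insert p S. 1 - 1 / real p) = (b - a) * ?P - (b / p - a / p) * ?P"
    using insert p by (simp add: field_simps)
  moreover have "(2 :: real) ^ card (insert p S) = 2 * 2 ^ card S" using insert by simp
  ultimately show ?case unfolding split by linarith
qed

lemma prod_half_pred_primes_large:
  fixes K :: nat
  assumes "q > K * fact (2 * K + 3)"
  shows "real q * (\<Prod>p\<in>prime_factors q. (1 - 1 / real p) / 2) > K / 2"
proof -
  let ?S = "prime_factors q"
  have q0: "q > 0" using assms by simp
  have pr: "prime p" "p \<ge> 2" if "p \<in> ?S" for p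
    using that by (auto simp: in_prime_factors_iff prime_ge_2_nat)
  have "\<Prod>?S dvd q"
  proof -
    have "(\<Prod>p\<in>?S. p) dvd (\<Prod>p\<in>?S. p ^ multiplicity p q)"
      using q0 by (intro prod_dvd_prod dvd_power) (auto simp: prime_factors_multiplicity)
    then show ?thesis using prime_factorization_nat[OF q0] by simp
  qed
  then obtain R where R: "q = \<Prod>?S * R" by blast
  have "R > 0" using R q0 by (metis gr0I mult_0_right less_irrefl)
  have eq: "real q * (\<Prod>p\<in>?S. (1 - 1 / real p) / 2) = real R * (\<Prod>p\<in>?S. (real p - 1) / 2)"
  proof -
    have "real q = real R * (\<Prod>p\<in>?S. real p)"
      using arg_cong[OF R, of real] by (simp only: of_nat_mult of_nat_prod mult.commute)
    then have "real q * (\<Prod>p\<in>?S. (1 - 1 / real p) / 2) = real R * (\<Prod>p\<in>?S. real p * ((1 - 1 / real p) / 2))"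
      by (simp only: prod.distrib mult.assoc)
    also have "(\<Prod>p\<in>?S. real p * ((1 - 1 / real p) / 2)) = (\<Prod>p\<in>?S. (real p - 1) / 2)"
    proof (intro prod.cong refl)
      fix p assume "p \<in> ?S"
      then show "real p * ((1 - 1 / real p) / 2) = (real p - 1) / 2"
        using pr(2)[of p] by (simp add: field_simps)
    qed
    finally show ?thesis .
  qed
  have ge: "(real p - 1) / 2 \<ge> 1" if "p \<in> ?S - {2}" for p
    using pr[of p] that by auto
  have half: "(\<Prod>p\<in>T. (real p - 1) / 2) \<ge> 1 / 2" if "T \<subseteq> ?S" for T
  proof -
    have fin: "finite T" using that finite_subset by blast
    have "1 \<le> (\<Prod>p\<in>T - {2}. (real p - 1) / 2)"
      by (rule prod_ge_1) (use ge that in auto)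
    then show ?thesis
    proof (cases "2 \<in> T")
      case True
      have "(\<Prod>p\<in>T. (real p - 1) / 2) = 1 / 2 * (\<Prod>p\<in>T - {2}. (real p - 1) / 2)"
        by (subst prod.remove[OF fin True]) simp
      then show ?thesis using \<open>1 \<le> _\<close> by linarith
    next
      case False
      then have "T - {2} = T" by simp
      then show ?thesis using \<open>1 \<le> _\<close> by (simp only:)
    qed
  qed
  show ?thesis
  proof (cases "R > K")
    case True
    then have "real K / 2 < real R * (1 / 2)" by simp
    also have "\<dots> \<le> real R * (\<Prod>p\<in>?S. (real p - 1) / 2)" by (intro mult_left_mono half) auto
    finally show ?thesis using eq by simp
  next
    case False
    have "\<exists>p\<in>?S. p > 2 * K + 3"
    proof (rule ccontr)
      assume "\<not> ?thesis"
      moreover have "1 \<le> p" if "p \<in> ?S" for p using pr(2)[OF that] by linarith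
      ultimately have "?S \<subseteq> {1..2 * K + 3}" by (force simp: not_less)
      then have "\<Prod>?S dvd \<Prod>{1..2 * K + 3}" by (intro prod_dvd_prod_subset) auto
      then have "\<Prod>?S \<le> fact (2 * K + 3)" by (simp add: fact_prod dvd_imp_le)
      then have "\<Prod>?S * R \<le> fact (2 * K + 3) * K" using False by (intro mult_mono) auto
      then have "q \<le> fact (2 * K + 3) * K" using R by metis
      then show False using assms by (simp add: mult.commute)
    qed
    then obtain p where p: "p \<in> ?S" "p > 2 * K + 3" by blast
    have "real K / 2 < 1 * ((real p - 1) / 2 * (1 / 2))" using p(2) by auto
    also have "\<dots> \<le> real R * ((real p - 1) / 2 * (\<Prod>p\<in>?S - {p}. (real p - 1) / 2))"
      using \<open>R > 0\<close> p by (intro mult_mono half) auto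
    also have "\<dots> = real R * (\<Prod>p\<in>?S. (real p - 1) / 2)"
      using prod.remove[OF _ p(1), of "\<lambda>p. (real p - 1) / 2"] by simp
    finally show ?thesis using eq by simp
  qed
qed

lemma coprime_fraction_in_interval:
  fixes x y :: real
  assumes "x < y"
  shows "\<exists>Q. \<forall>q>Q. \<exists>p::int. coprime p (int q) \<and> x < p / q \<and> p / q \<le> y"
proof -
  obtain K :: nat where K: "2 / (y - x) \<le> real K" using real_arch_simple by blast
  show ?thesis
  proof (rule exI[of _ "K * fact (2 * K + 3)"], intro allI impI)
    fix q :: nat assume q: "K * fact (2 * K + 3) < q"
    let ?S = "prime_factors q"
    have q0: "q > 0" using q by simp
    have pr: "prime p" if "p \<in> ?S" for p using that by auto
    have "(y - x) * (K / 2) < (y - x) * (real q * (\<Prod>p\<in>?S. (1 - 1 / real p) / 2))"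
      using prod_half_pred_primes_large[OF q] assms by (intro mult_strict_left_mono) auto
    moreover have "1 \<le> (y - x) * (K / 2)" using K assms by (simp add: field_simps)
    ultimately have "1 < (y - x) * (real q * (\<Prod>p\<in>?S. (1 - 1 / real p) / 2))" by linarith
    then have "2 ^ card ?S < (y * q - x * q) * (\<Prod>p\<in>?S. 1 - 1 / real p)"
      by (simp add: prod_dividef field_simps)
    moreover have "x * q \<le> y * q" using assms by (simp add: mult_right_mono)
    ultimately have "card (unsieved ?S (x * q) (y * q)) > 0"
      using card_unsieved[of ?S "x * q" "y * q"] pr by fastforce
    then obtain p where p: "p \<in> unsieved ?S (x * q) (y * q)" by (metis card.empty equals0I less_irrefl)
    have "coprime p (int q)"
    proof (rule ccontr)
      assume "\<not> coprime p (int q)"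
      then have "gcd p (int q) \<noteq> 1" by (simp add: coprime_iff_gcd_eq_1)
      then have "nat (gcd p (int q)) \<noteq> 1" by simp
      then obtain s where s: "prime s" "s dvd nat (gcd p (int q))" using prime_factor_nat by blast
      then have "int s dvd gcd p (int q)" by (metis gcd_ge_0_int int_nat_eq of_nat_dvd_iff)
      then have "int s dvd p" "int s dvd int q" by auto
      then have "s \<in> ?S" using s q0 by (auto simp: in_prime_factors_iff)
      then show False using p \<open>int s dvd p\<close> by (auto simp: unsieved_def)
    qed
    then show "\<exists>p::int. coprime p (int q) \<and> x < p / q \<and> p / q \<le> y"
      using p q0 by (intro exI[of _ p]) (auto simp: unsieved_def field_simps)
  qed
qed

section \<open>Birkhoff sums near rational rotations\<close>

lemma birkhoff_sum_add: "birkhoff_sum f \<alpha> (m + n) x = birkhoff_sum f \<alpha> m x + birkhoff_sum f \<alpha> n (x + m * \<alpha>)"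
  by (induction n) (simp_all add: birkhoff_sum_def algebra_simps)

lemma birkhoff_sum_birkhoff_sum:
  "birkhoff_sum (\<lambda>x. birkhoff_sum f \<alpha> r (real r * x)) \<alpha> n x = birkhoff_sum f \<alpha> (r * n) (real r * x)"
proof (induction n)
  case (Suc n)
  then show ?case
    using birkhoff_sum_add[of f \<alpha> "r * n" r "real r * x"]
    by (simp add: birkhoff_sum_Suc algebra_simps)
qed (simp add: birkhoff_sum_def)

lemma birkhoff_sum_periodic:
  assumes "\<And>x. f (x + 1) = f x"
  shows "birkhoff_sum f \<alpha> n (x + of_int k) = birkhoff_sum f \<alpha> n x"
  unfolding birkhoff_sum_def
proof (rule sum.cong[OF refl])
  fix j
  show "f (x + of_int k + real j * \<alpha>) = f (x + real j * \<alpha>)"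
    using periodic_of_int[of f 1 "x + real j * \<alpha>" k] assms by (simp add: algebra_simps)
qed

lemma fold_sum_eq_birkhoff_sum: "fold_sum f q = birkhoff_sum f (1 / real q) q"
  by (simp add: fun_eq_iff fold_sum_def birkhoff_sum_def)

lemma birkhoff_sum_eq_AE:
  assumes [measurable]: "f \<in> borel_measurable borel" "g \<in> borel_measurable borel"
    and eq: "AE x in lborel. f x = g x"
  shows "AE x in lborel. birkhoff_sum f \<alpha> n x = birkhoff_sum g \<alpha> n x"
proof -
  have "AE x in lborel. f (real j * \<alpha> + 1 * x) = g (real j * \<alpha> + 1 * x)" for j
    by (rule AE_borel_affine[where P="\<lambda>x. f x = g x"]) (use eq in auto)
  then have "AE x in lborel. \<forall>j. f (real j * \<alpha> + 1 * x) = g (real j * \<alpha> + 1 * x)"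
    by (simp add: AE_all_countable)
  then show ?thesis
    by eventually_elim (simp add: birkhoff_sum_def add.commute)
qed

lemma fold_sum_shift:
  assumes per: "\<And>x. g (x + 1) = g x" and "q > 0"
  shows "fold_sum g q (x + 1 / real q) = fold_sum g q x"
proof -
  let ?k = "\<lambda>j. g (x + real j / real q)"
  have "fold_sum g q (x + 1 / real q) = (\<Sum>j<q. ?k (Suc j))"
    unfolding fold_sum_def by (intro sum.cong) (simp_all add: add_divide_distrib algebra_simps)
  also have "\<dots> = (\<Sum>j<Suc q. ?k j) - ?k 0" by (subst sum.lessThan_Suc_shift) simp
  also have "\<dots> = fold_sum g q x" using assms by (simp add: fold_sum_def)
  finally show ?thesis .
qed

lemma bij_betw_mult_mod:
  assumes "coprime p (int q)" "q > 0"
  shows "bij_betw (\<lambda>j. nat (int j * p mod int q)) {..<q} {..<q}"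
proof -
  have "inj_on (\<lambda>j. nat (int j * p mod int q)) {..<q}"
  proof (rule inj_onI)
    fix i j assume ij: "i \<in> {..<q}" "j \<in> {..<q}" and "nat (int i * p mod int q) = nat (int j * p mod int q)"
    moreover have "int (nat (int k * p mod int q)) = int k * p mod int q" for k using assms(2) by simp
    ultimately have "int i * p mod int q = int j * p mod int q" by metis
    then have "int q dvd (int i - int j) * p" by (simp add: mod_eq_dvd_iff left_diff_distrib)
    then have "int q dvd int i - int j"
      using assms(1) by (simp add: coprime_dvd_mult_left_iff coprime_commute)
    then show "i = j" using ij zdvd_imp_le[of "int q" "\<bar>int i - int j\<bar>"] by fastforce
  qed
  moreover have "(\<lambda>j. nat (int j * p mod int q)) ` {..<q} \<subseteq> {..<q}"
    using assms(2) by (auto simp: nat_less_iff)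
  ultimately show ?thesis by (simp add: bij_betw_def endo_inj_surj)
qed

lemma birkhoff_sum_rational:
  assumes per: "\<And>x. g (x + 1) = g x" and "coprime p (int q)" "q > 0"
  shows "birkhoff_sum g (of_int p / real q) (h * q) x = real h * fold_sum g q x"
proof -
  have one: "birkhoff_sum g (of_int p / real q) q x = fold_sum g q x" for x
  proof -
    have "g (x + real j * (of_int p / real q)) = g (x + real (nat (int j * p mod int q)) / real q)" for j
    proof -
      let ?m = "int j * p mod int q" and ?d = "int j * p div int q"
      have "real j * of_int p = of_int ?m + of_int ?d * real q"
        by (metis mod_div_mult_eq of_int_add of_int_mult of_int_of_nat_eq)
      moreover have "real (nat ?m) = of_int ?m" using assms(3) by simp
      ultimately have "x + real j * (of_int p / real q) = x + real (nat ?m) / real q + of_int ?d * 1"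
        using assms(3) by (simp add: field_simps)
      then show ?thesis using periodic_of_int[of g 1, OF per] by metis
    qed
    then show ?thesis
      unfolding birkhoff_sum_def fold_sum_def
      using sum.reindex_bij_betw[OF bij_betw_mult_mod[OF assms(2,3)], of "\<lambda>j. g (x + real j / real q)"] by simp
  qed
  show ?thesis
  proof (induction h)
    case (Suc h)
    have "birkhoff_sum g (of_int p / real q) (Suc h * q) x
       = birkhoff_sum g (of_int p / real q) (h * q) x + birkhoff_sum g (of_int p / real q) q (x + of_int (int h * p))"
      using birkhoff_sum_add[of g "of_int p / real q" "h * q" q x] assms(3) by (simp add: add.commute)
    also have "\<dots> = real h * fold_sum g q x + fold_sum g q x"
      by (subst birkhoff_sum_periodic[of g, OF per]) (simp add: Suc one)
    finally show ?case by (simp add: algebra_simps)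
  qed (simp add: birkhoff_sum_def)
qed

lemma birkhoff_sum_perturb:
  fixes g :: "real \<Rightarrow> real"
  assumes g: "uniformly_continuous_on UNIV g" and "e > 0"
  shows "\<exists>\<epsilon>>0. \<forall>\<alpha> \<beta> N. \<bar>\<alpha> - \<beta>\<bar> < \<epsilon> \<longrightarrow> real N \<le> L \<longrightarrow>
    real N * \<bar>\<alpha> - \<beta>\<bar> \<le> e \<and> (\<forall>x. \<bar>birkhoff_sum g \<alpha> N x - birkhoff_sum g \<beta> N x\<bar> \<le> e)"
proof -
  define M where "M = max L 1"
  have M: "M \<ge> 1" "L \<le> M" by (auto simp: M_def)
  obtain \<delta> where \<delta>: "\<delta> > 0" "\<And>x y. dist y x < \<delta> \<Longrightarrow> dist (g y) (g x) < e / M"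
    using g \<open>e > 0\<close> M unfolding uniformly_continuous_on_def
    by (metis UNIV_I divide_pos_pos less_le_trans zero_less_one)
  show ?thesis
  proof (intro exI conjI allI impI)
    show "min (\<delta> / M) (e / M) > 0" using \<delta> \<open>e > 0\<close> M by simp
    fix \<alpha> \<beta> :: real and N :: nat
    assume d: "\<bar>\<alpha> - \<beta>\<bar> < min (\<delta> / M) (e / M)" and N: "real N \<le> L"
    have "real N * \<bar>\<alpha> - \<beta>\<bar> \<le> M * (e / M)" using d N M by (intro mult_mono) auto
    then show "real N * \<bar>\<alpha> - \<beta>\<bar> \<le> e" using M by simp
    fix x
    have "\<bar>birkhoff_sum g \<alpha> N x - birkhoff_sum g \<beta> N x\<bar> = \<bar>\<Sum>j<N. g (x + real j * \<alpha>) - g (x + real j * \<beta>)\<bar>"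
      by (simp add: birkhoff_sum_def sum_subtractf)
    also have "\<dots> \<le> (\<Sum>j<N. \<bar>g (x + real j * \<alpha>) - g (x + real j * \<beta>)\<bar>)" by (rule sum_abs)
    also have "\<dots> \<le> (\<Sum>j<N. e / M)"
    proof (rule sum_mono)
      fix j assume "j \<in> {..<N}"
      then have "real j * \<bar>\<alpha> - \<beta>\<bar> \<le> M * \<bar>\<alpha> - \<beta>\<bar>" using N M by (intro mult_right_mono) auto
      also have "\<dots> < M * (\<delta> / M)" using d M by (intro mult_strict_left_mono) auto
      also have "\<dots> = \<delta>" using M by simp
      finally have "dist (x + real j * \<alpha>) (x + real j * \<beta>) < \<delta>"
        by (simp add: dist_real_def abs_mult flip: right_diff_distrib)
      then show "\<bar>g (x + real j * \<alpha>) - g (x + real j * \<beta>)\<bar> \<le> e / M"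
        using \<delta>(2)[of "x + real j * \<alpha>" "x + real j * \<beta>"] by (simp add: dist_real_def)
    qed
    also have "\<dots> = real N * (e / M)" by simp
    also have "\<dots> \<le> M * (e / M)" using N M \<open>e > 0\<close> by (intro mult_right_mono) auto
    also have "\<dots> = e" using M by simp
    finally show "\<bar>birkhoff_sum g \<alpha> N x - birkhoff_sum g \<beta> N x\<bar> \<le> e" .
  qed
qed

lemma uniformly_continuous_periodic:
  fixes g :: "real \<Rightarrow> real"
  assumes "continuous_on UNIV g" and per: "\<And>x. g (x + 1) = g x"
  shows "uniformly_continuous_on UNIV g"
  unfolding uniformly_continuous_on_def
proof (intro allI impI)
  fix e :: real assume "e > 0"
  have "uniformly_continuous_on {-1..2} g"
    by (rule compact_uniformly_continuous) (use assms(1) continuous_on_subset in auto)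
  then obtain d where d: "d > 0" "\<And>x y. x \<in> {-1..2} \<Longrightarrow> y \<in> {-1..2} \<Longrightarrow> dist y x < d \<Longrightarrow> dist (g y) (g x) < e"
    unfolding uniformly_continuous_on_def using \<open>e > 0\<close> by meson
  have "dist (g y) (g x) < e" if "dist y x < min d 1" for x y
  proof -
    define k where "k = \<lfloor>x\<rfloor>"
    have k: "0 \<le> x - k" "x - k < 1" by (auto simp: k_def) linarith
    have "g (x - of_int k) = g x" "g (y - of_int k) = g y"
      using periodic_of_int[of g 1 "x - of_int k" k] periodic_of_int[of g 1 "y - of_int k" k] per by simp_all
    moreover have "dist (g (y - of_int k)) (g (x - of_int k)) < e"
      by (rule d(2)) (use that k in \<open>auto simp: dist_real_def\<close>)
    ultimately show ?thesis by simp
  qed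
  then show "\<exists>d>0. \<forall>x\<in>UNIV. \<forall>y\<in>UNIV. dist y x < d \<longrightarrow> dist (g y) (g x) < e"
    using d(1) by (intro exI[of _ "min d 1"]) auto
qed

lemma nn_integral_period_scale:
  fixes k :: "real \<Rightarrow> ennreal"
  assumes [measurable]: "k \<in> borel_measurable borel" and per: "\<And>x. k (x + 1) = k x" and "r > 0"
  shows "(\<integral>\<^sup>+w. k (real r * w) * indicator {0..<1} w \<partial>lborel) = (\<integral>\<^sup>+w. k w * indicator {0..<1} w \<partial>lborel)"
proof -
  let ?I = "\<integral>\<^sup>+w. k w * indicator {0..<1} w \<partial>lborel"
  have block: "(\<integral>\<^sup>+w. k w * indicator {0..<real n} w \<partial>lborel) = ennreal (real n) * ?I" for n
  proof (induction n)
    case (Suc n)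
    have "(\<integral>\<^sup>+w. k w * indicator {0..<real (Suc n)} w \<partial>lborel)
      = (\<integral>\<^sup>+w. k w * indicator {0..<real n} w + k w * indicator {real n..<real n + 1} w \<partial>lborel)"
      by (intro nn_integral_cong) (auto simp: indicator_def)
    also have "\<dots> = ennreal (real n) * ?I + (\<integral>\<^sup>+w. k w * indicator {real n..<real n + 1} w \<partial>lborel)"
      by (subst nn_integral_add) (auto simp: Suc)
    also have "(\<integral>\<^sup>+w. k w * indicator {real n..<real n + 1} w \<partial>lborel)
      = (\<integral>\<^sup>+w. k (real n + 1 * w) * indicator {real n..<real n + 1} (real n + 1 * w) \<partial>lborel)"
      by (subst nn_integral_real_affine[where c=1 and t="real n"]) auto
    also have "\<dots> = (\<integral>\<^sup>+w. k (real n + w) * indicator {0..<1} w \<partial>lborel)"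
      by (intro nn_integral_cong) (auto simp: indicator_def)
    also have "\<dots> = ?I" by (rule nn_integral_period_shift) (use per in auto)
    finally show ?case
      by (simp add: ennreal_plus distrib_right add.commute)
  qed simp
  have "ennreal (real r) * ?I = (\<integral>\<^sup>+w. k w * indicator {0..<real r} w \<partial>lborel)" by (rule block[symmetric])
  also have "\<dots> = ennreal (real r) * (\<integral>\<^sup>+w. k (0 + real r * w) * indicator {0..<real r} (0 + real r * w) \<partial>lborel)"
    using \<open>r > 0\<close> by (subst nn_integral_real_affine[where c="real r" and t=0]) auto
  also have "(\<integral>\<^sup>+w. k (0 + real r * w) * indicator {0..<real r} (0 + real r * w) \<partial>lborel)
      = (\<integral>\<^sup>+w. k (real r * w) * indicator {0..<1} w \<partial>lborel)"
    using \<open>r > 0\<close> by (intro nn_integral_cong) (auto simp: indicator_def zero_le_mult_iff)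
  finally show ?thesis using \<open>r > 0\<close> by (simp add: ennreal_mult_cancel_left)
qed

lemma emeasure_level_set:
  fixes F :: "real \<Rightarrow> real"
  assumes F: "continuous_on UNIV F" and bd: "\<And>x. \<bar>F x\<bar> \<le> M" and "M > 0"
    and L2: "\<sigma>\<^sup>2 \<le> (\<integral>x. indicator {0..1} x *\<^sub>R (F x)\<^sup>2 \<partial>lborel)"
  shows "ennreal (3 / 4 * \<sigma>\<^sup>2 / M\<^sup>2) \<le> emeasure lborel {w \<in> {0..<1}. \<sigma> / 2 \<le> \<bar>F w\<bar>}"
proof -
  have [measurable]: "F \<in> borel_measurable borel" by (rule borel_measurable_continuous_onI[OF F])
  define S where "S = {w \<in> {0..<1}. \<sigma> / 2 \<le> \<bar>F w\<bar>}"
  have S [measurable]: "S \<in> sets borel" unfolding S_def by measurable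
  have "emeasure lborel S \<le> emeasure lborel {0..<1 :: real}" by (rule emeasure_mono) (auto simp: S_def)
  then have fin: "emeasure lborel S < \<infinity>" by (auto simp: le_less_trans)
  have "integrable lborel (\<lambda>x. indicator {0..1} x *\<^sub>R (F x)\<^sup>2)"
    using borel_integrable_atLeastAtMost'[of 0 1 "\<lambda>x. (F x)\<^sup>2"] continuous_on_subset[OF F]
    by (auto simp: set_integrable_def intro!: continuous_intros)
  moreover have "AE x in lborel. x \<noteq> (1 :: real)" by (rule AE_lborel_singleton)
  then have "AE x in lborel. indicator {0..1} x *\<^sub>R (F x)\<^sup>2 \<le> indicator {0..1} x * (\<sigma>\<^sup>2 / 4) + indicator S x * M\<^sup>2"
  proof eventually_elim
    case (elim x)
    have b: "(F x)\<^sup>2 \<le> M\<^sup>2" using bd[of x] \<open>M > 0\<close> by (simp add: abs_le_square_iff[symmetric])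
    have "(F x)\<^sup>2 \<le> (\<sigma> / 2)\<^sup>2" if "x \<notin> S" "0 \<le> x" "x < 1"
      using that by (auto simp: S_def abs_le_square_iff[symmetric])
    then show ?case using elim b
      by (cases "x \<in> S") (auto simp: indicator_def power_divide intro: add_increasing)
  qed
  ultimately have "(\<integral>x. indicator {0..1} x *\<^sub>R (F x)\<^sup>2 \<partial>lborel)
    \<le> (\<integral>x. indicator {0..1} x * (\<sigma>\<^sup>2 / 4) + indicator S x * M\<^sup>2 \<partial>lborel)"
    using fin by (intro integral_mono_AE) auto
  also have "\<dots> = \<sigma>\<^sup>2 / 4 + measure lborel S * M\<^sup>2"
    using fin by (subst Bochner_Integration.integral_add) auto
  finally have "3 / 4 * \<sigma>\<^sup>2 \<le> measure lborel S * M\<^sup>2" using L2 by simp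
  then have "3 / 4 * \<sigma>\<^sup>2 / M\<^sup>2 \<le> measure lborel S" using \<open>M > 0\<close> by (simp add: divide_le_eq)
  then have "ennreal (3 / 4 * \<sigma>\<^sup>2 / M\<^sup>2) \<le> ennreal (measure lborel S)" by (rule ennreal_leI)
  also have "\<dots> = emeasure lborel S" using fin by (simp add: emeasure_eq_ennreal_measure)
  finally show ?thesis by (simp add: S_def)
qed

lemma integrable_of_square_integrable:
  fixes f :: "real \<Rightarrow> real"
  assumes "f \<in> borel_measurable borel" and L2: "integrable (lebesgue_on {0..1}) (\<lambda>x. (f x)\<^sup>2)"
  shows "integrable (lebesgue_on {0..1}) f"
proof (rule Bochner_Integration.integrable_bound)
  show "integrable (lebesgue_on {0..1}) (\<lambda>x. 1 + (f x)\<^sup>2)"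
    using L2 by (intro Bochner_Integration.integrable_add) (auto simp: integrable_restrict_space)
  show "f \<in> borel_measurable (lebesgue_on {0..1})"
    using assms(1) by (auto intro!: measurable_restrict_space1 measurable_completion)
  have "\<bar>f x\<bar> \<le> 1 + (f x)\<^sup>2" for x
  proof -
    have "\<bar>f x\<bar> * 2 \<le> 1 + \<bar>f x\<bar>\<^sup>2" using zero_le_power2[of "1 - \<bar>f x\<bar>"] by (simp add: power2_diff)
    then show ?thesis by simp
  qed
  then show "AE x in lebesgue_on {0..1}. norm (f x) \<le> norm (1 + (f x)\<^sup>2)"
    by (intro AE_I2) simp
qed

lemma L2_norm_T_square:
  assumes [measurable]: "F \<in> borel_measurable borel" "G \<in> borel_measurable borel" and "AE x in lborel. F x = G x"
  shows "(L2_norm_T F)\<^sup>2 = (\<integral>x. indicator {0..1} x *\<^sub>R (G x)\<^sup>2 \<partial>lborel)"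
proof -
  have "(L2_norm_T F)\<^sup>2 = integral\<^sup>L (lebesgue_on {0..1}) (\<lambda>x. (F x)\<^sup>2)"
    unfolding L2_norm_T_def by (rule real_sqrt_pow2) simp
  also have "\<dots> = (\<integral>x. indicator {0..1} x *\<^sub>R (F x)\<^sup>2 \<partial>lborel)"
    by (rule integral_lebesgue_on_conv_lborel) auto
  also have "\<dots> = (\<integral>x. indicator {0..1} x *\<^sub>R (G x)\<^sup>2 \<partial>lborel)"
    by (rule integral_cong_AE) (use assms(3) in \<open>auto elim!: eventually_mono\<close>)
  finally show ?thesis .
qed

lemma ergodic_skew_of_approximations:
  fixes f g :: "real \<Rightarrow> real" and p :: "nat \<Rightarrow> int" and q :: "nat \<Rightarrow> nat" and s \<omega> :: "nat \<Rightarrow> real"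
  assumes f [measurable]: "f \<in> borel_measurable borel" and fper: "\<And>x. f (x + 1) = f x"
    and g: "continuous_on UNIV g" and gper: "\<And>x. g (x + 1) = g x" and fg: "AE x in lborel. f x = g x"
    and "\<alpha> \<notin> \<rat>" "C > 0" "r \<ge> 1"
    and cop: "\<And>k. coprime (p k) (int (q k))" "\<And>k. q k > 0"
    and s: "\<And>k. s k > 0" "s \<longlonglongrightarrow> 0" and q: "filterlim q at_top sequentially" and \<omega>: "filterlim \<omega> at_top sequentially"
    and bd: "\<And>k x. \<bar>fold_sum g (q k) x\<bar> \<le> C * s k"
    and L2: "\<And>k. (\<integral>x. indicator {0..1} x *\<^sub>R (fold_sum g (q k) x)\<^sup>2 \<partial>lborel) = (s k)\<^sup>2"
    and close: "\<And>k N. real N \<le> \<omega> k * real (q k) / s k \<Longrightarrow> real N * \<bar>\<alpha> - p k / q k\<bar> \<le> 1 / \<omega> k \<and>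
       (\<forall>x. \<bar>birkhoff_sum g \<alpha> N x - birkhoff_sum g (p k / q k) N x\<bar> \<le> 1 / \<omega> k)"
  shows "ergodic_skew \<alpha> (\<lambda>x. birkhoff_sum f \<alpha> r (real r * x))"
proof (rule ergodic_skew_criterion[OF _ _ \<open>\<alpha> \<notin> \<rat>\<close>])
  show "(\<lambda>x. birkhoff_sum f \<alpha> r (real r * x)) \<in> borel_measurable borel" by measurable
  show "birkhoff_sum f \<alpha> r (real r * (x + 1)) = birkhoff_sum f \<alpha> r (real r * x)" for x
    using birkhoff_sum_periodic[of f \<alpha> r "real r * x" "int r"] fper by (simp add: distrib_left)
  have [measurable]: "g \<in> borel_measurable borel" by (rule borel_measurable_continuous_onI[OF g])
  fix b :: real assume "b > 0"
  define \<sigma> where "\<sigma> = b / (2 * C)"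
  have \<sigma>: "\<sigma> > 0" "2 * \<sigma> * C = b" using \<open>b > 0\<close> \<open>C > 0\<close> by (simp_all add: \<sigma>_def)
  define \<kappa> where "\<kappa> = 3 / 4 * \<sigma>\<^sup>2 / b\<^sup>2"
  have "\<exists>n (m :: int) \<rho> \<psi>. 0 < \<rho> \<and> \<rho> < \<eta> \<and> \<psi> \<in> borel_measurable borel \<and>
        (\<forall>x. \<psi> (x + \<rho>) = \<psi> x) \<and> (\<forall>x. \<psi> (x + 1) = \<psi> x) \<and> (\<forall>x. \<bar>\<psi> x\<bar> \<le> b) \<and>
        ennreal \<kappa> \<le> emeasure lborel {w \<in> {0..<1}. \<sigma> / 2 \<le> \<bar>\<psi> w\<bar>} \<and>
        \<bar>real n * \<alpha> - m\<bar> < \<eta> \<and>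
        (AE x in lborel. \<bar>birkhoff_sum (\<lambda>x. birkhoff_sum f \<alpha> r (real r * x)) \<alpha> n x - \<psi> x\<bar> < \<eta>)"
    if "\<eta> > 0" for \<eta>
  proof -
    have "\<forall>\<^sub>F k in sequentially. real r * s k < \<sigma>"
      using tendsto_mult_right_zero[OF s(2), of "real r"] \<sigma>(1) by (rule order_tendstoD(2))
    moreover have "\<forall>\<^sub>F k in sequentially. nat \<lceil>1 / \<eta>\<rceil> + 1 \<le> q k"
      using q by (simp add: filterlim_at_top)
    moreover have "\<forall>\<^sub>F k in sequentially. max (1 / \<eta> + 1) (2 * \<sigma>) \<le> \<omega> k"
      using \<omega> unfolding filterlim_at_top by blast
    ultimately have "\<forall>\<^sub>F k in sequentially. real r * s k < \<sigma> \<and> nat \<lceil>1 / \<eta>\<rceil> + 1 \<le> q k \<and> max (1 / \<eta> + 1) (2 * \<sigma>) \<le> \<omega> k"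
      by eventually_elim simp
    then obtain k where k: "real r * s k < \<sigma>" "nat \<lceil>1 / \<eta>\<rceil> + 1 \<le> q k" "1 / \<eta> + 1 \<le> \<omega> k" "2 * \<sigma> \<le> \<omega> k"
      by (auto simp: eventually_sequentially)
    have rs: "real r * s k > 0" using s(1)[of k] \<open>r \<ge> 1\<close> by simp
    have \<omega>0: "\<omega> k > 0" using k(4) \<sigma>(1) by linarith
    have \<omega>\<eta>: "1 / \<omega> k < \<eta>" using k(3) \<omega>0 \<open>\<eta> > 0\<close> by (simp add: field_simps)
    have q\<eta>: "1 / \<eta> < real (q k)" using k(2) by linarith
    define h where "h = nat \<lceil>\<sigma> / (real r * s k)\<rceil>"
    have h: "\<sigma> \<le> real h * (real r * s k)" "real h * (real r * s k) \<le> 2 * \<sigma>"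
    proof -
      have "\<sigma> / (real r * s k) > 0" using \<sigma>(1) rs by (rule divide_pos_pos)
      then have "\<sigma> / (real r * s k) \<le> real h" "real h \<le> \<sigma> / (real r * s k) + 1"
        unfolding h_def by linarith+
      moreover from this(2) have "real h * (real r * s k) \<le> (\<sigma> / (real r * s k) + 1) * (real r * s k)"
        using rs by (intro mult_right_mono) auto
      moreover have "(\<sigma> / d + 1) * d = \<sigma> + d" if "d > 0" for d
        using that by (simp add: distrib_right)
      from this[OF rs] have "(\<sigma> / (real r * s k) + 1) * (real r * s k) = \<sigma> + real r * s k" .
      ultimately show "\<sigma> \<le> real h * (real r * s k)" "real h * (real r * s k) \<le> 2 * \<sigma>"
        using rs k(1) by (simp_all add: pos_divide_le_eq)
    qed
    define n where "n = h * q k"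
    define N where "N = r * n"
    define F where "F = (\<lambda>y. real (r * h) * fold_sum g (q k) y)"
    have "real N = real h * (real r * s k) * (real (q k) / s k)"
      using s(1)[of k] by (simp add: N_def n_def)
    also have "\<dots> \<le> \<omega> k * (real (q k) / s k)"
      using h(2) k(4) s(1)[of k] by (intro mult_right_mono) auto
    finally have cl: "real N * \<bar>\<alpha> - p k / q k\<bar> \<le> 1 / \<omega> k"
        "\<And>x. \<bar>birkhoff_sum g \<alpha> N x - birkhoff_sum g (p k / q k) N x\<bar> \<le> 1 / \<omega> k"
      using close[of N k] by auto
    have Fb: "birkhoff_sum g (p k / q k) N y = F y" for y
      using birkhoff_sum_rational[of g, OF gper cop(1) cop(2), of k "r * h" y]
      by (simp add: F_def N_def n_def mult.assoc)
    have Fc: "continuous_on UNIV F"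
      unfolding F_def fold_sum_def
      by (intro continuous_intros continuous_on_compose2[OF g]) auto
    then have [measurable]: "F \<in> borel_measurable borel" by (rule borel_measurable_continuous_onI)
    have Fbd: "\<bar>F y\<bar> \<le> b" for y
    proof -
      have "\<bar>F y\<bar> = real (r * h) * \<bar>fold_sum g (q k) y\<bar>" by (simp add: F_def abs_mult)
      also have "\<dots> \<le> real (r * h) * (C * s k)" by (intro mult_left_mono bd) auto
      also have "\<dots> = real h * (real r * s k) * C" by simp
      also have "\<dots> \<le> 2 * \<sigma> * C" using h(2) \<open>C > 0\<close> by (intro mult_right_mono) auto
      finally show ?thesis using \<sigma>(2) by simp
    qed
    have Fper: "F (y + of_int i) = F y" for y i
      using birkhoff_sum_periodic[of g "1 / real (q k)" "q k" y i] gper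
      by (simp add: F_def fold_sum_eq_birkhoff_sum)
    have FL2: "\<sigma>\<^sup>2 \<le> (\<integral>x. indicator {0..1} x *\<^sub>R (F x)\<^sup>2 \<partial>lborel)"
    proof -
      have "(\<integral>x. indicator {0..1} x *\<^sub>R (F x)\<^sup>2 \<partial>lborel)
        = (\<integral>x. (real (r * h))\<^sup>2 * (indicator {0..1} x *\<^sub>R (fold_sum g (q k) x)\<^sup>2) \<partial>lborel)"
        by (intro Bochner_Integration.integral_cong) (auto simp: F_def power_mult_distrib)
      also have "\<dots> = (real (r * h))\<^sup>2 * (s k)\<^sup>2"
        by (subst integral_mult_right_zero) (simp only: L2)
      also have "\<dots> = (real h * (real r * s k))\<^sup>2" by (simp add: power_mult_distrib)
      also have "\<dots> \<ge> \<sigma>\<^sup>2" using h(1) \<sigma>(1) by (intro power_mono) auto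
      finally show ?thesis .
    qed
    have level: "ennreal \<kappa> \<le> emeasure lborel {w \<in> {0..<1}. \<sigma> / 2 \<le> \<bar>F (real r * w)\<bar>}"
    proof -
      let ?k = "\<lambda>w. indicator {w. \<sigma> / 2 \<le> \<bar>F w\<bar>} w :: ennreal"
      have em: "emeasure lborel {w \<in> {0..<1}. \<sigma> / 2 \<le> \<bar>F (c * w)\<bar>} = (\<integral>\<^sup>+w. ?k (c * w) * indicator {0..<1} w \<partial>lborel)" for c
      proof -
        have "{w \<in> {0..<1}. \<sigma> / 2 \<le> \<bar>F (c * w)\<bar>} \<in> sets lborel" by measurable
        then have "emeasure lborel {w \<in> {0..<1}. \<sigma> / 2 \<le> \<bar>F (c * w)\<bar>}
          = (\<integral>\<^sup>+w. indicator {w \<in> {0..<1}. \<sigma> / 2 \<le> \<bar>F (c * w)\<bar>} w \<partial>lborel)"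
          by (rule nn_integral_indicator[symmetric])
        also have "\<dots> = (\<integral>\<^sup>+w. ?k (c * w) * indicator {0..<1} w \<partial>lborel)"
          by (rule nn_integral_cong) (auto simp: indicator_def)
        finally show ?thesis .
      qed
      have "ennreal \<kappa> \<le> emeasure lborel {w \<in> {0..<1}. \<sigma> / 2 \<le> \<bar>F w\<bar>}"
        unfolding \<kappa>_def by (rule emeasure_level_set[OF Fc Fbd \<open>b > 0\<close> FL2])
      also have "\<dots> = (\<integral>\<^sup>+w. ?k w * indicator {0..<1} w \<partial>lborel)"
        using em[of 1] by simp
      also have "\<dots> = (\<integral>\<^sup>+w. ?k (real r * w) * indicator {0..<1} w \<partial>lborel)"
        by (rule nn_integral_period_scale[symmetric])
          (use Fper[of _ 1] \<open>r \<ge> 1\<close> in \<open>auto simp: indicator_def\<close>)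
      also have "\<dots> = emeasure lborel {w \<in> {0..<1}. \<sigma> / 2 \<le> \<bar>F (real r * w)\<bar>}"
        by (rule em[symmetric])
      finally show ?thesis .
    qed
    show ?thesis
    proof (intro exI conjI allI)
      let ?\<rho> = "1 / (real r * real (q k))" and ?\<psi> = "\<lambda>x. F (real r * x)"
      show "0 < ?\<rho>" using cop(2)[of k] \<open>r \<ge> 1\<close> by simp
      have "?\<rho> \<le> 1 / real (q k)" using \<open>r \<ge> 1\<close> cop(2)[of k] by (intro divide_left_mono) auto
      also have "\<dots> < \<eta>" using q\<eta> \<open>\<eta> > 0\<close> cop(2)[of k] by (simp add: field_simps)
      finally show "?\<rho> < \<eta>" .
      show "?\<psi> \<in> borel_measurable borel" by measurable
      show "?\<psi> (x + ?\<rho>) = ?\<psi> x" for x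
        using fold_sum_shift[of g "q k" "real r * x", OF gper cop(2)] \<open>r \<ge> 1\<close>
        by (simp add: F_def distrib_left)
      show "?\<psi> (x + 1) = ?\<psi> x" for x using Fper[of "real r * x" "int r"] by (simp add: distrib_left)
      show "\<bar>?\<psi> x\<bar> \<le> b" for x by (rule Fbd)
      show "ennreal \<kappa> \<le> emeasure lborel {w \<in> {0..<1}. \<sigma> / 2 \<le> \<bar>?\<psi> w\<bar>}" by (rule level)
      have "real n * \<alpha> - of_int (int h * p k) = real n * (\<alpha> - p k / q k)"
        using cop(2)[of k] by (simp add: n_def field_simps)
      then have "\<bar>real n * \<alpha> - of_int (int h * p k)\<bar> = real n * \<bar>\<alpha> - p k / q k\<bar>" by (simp add: abs_mult)
      also have "\<dots> \<le> real N * \<bar>\<alpha> - p k / q k\<bar>"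
        using \<open>r \<ge> 1\<close> mult_right_mono[of 1 "real r" "real n"]
        by (intro mult_right_mono) (simp_all add: N_def)
      finally show "\<bar>real n * \<alpha> - of_int (int h * p k)\<bar> < \<eta>" using cl(1) \<omega>\<eta> by linarith
      have "AE x in lborel. birkhoff_sum f \<alpha> N (0 + real r * x) = birkhoff_sum g \<alpha> N (0 + real r * x)"
        by (rule AE_borel_affine[where P="\<lambda>x. birkhoff_sum f \<alpha> N x = birkhoff_sum g \<alpha> N x"])
          (use \<open>r \<ge> 1\<close> birkhoff_sum_eq_AE[OF _ _ fg] in auto)
      then show "AE x in lborel. \<bar>birkhoff_sum (\<lambda>x. birkhoff_sum f \<alpha> r (real r * x)) \<alpha> n x - ?\<psi> x\<bar> < \<eta>"
      proof eventually_elim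
        case (elim x)
        have "\<bar>birkhoff_sum g \<alpha> N (real r * x) - F (real r * x)\<bar> \<le> 1 / \<omega> k"
          using cl(2)[of "real r * x"] by (simp add: Fb)
        then show ?case using elim \<omega>\<eta> by (simp add: birkhoff_sum_birkhoff_sum N_def)
      qed
    qed
  qed
  then have "periodically_approximable (\<lambda>x. birkhoff_sum f \<alpha> r (real r * x)) \<alpha> (\<sigma> / 2) b \<kappa>"
    by (simp only: periodically_approximable_def) blast
  then show "\<exists>a \<kappa>. a > 0 \<and> \<kappa> > 0 \<and> periodically_approximable (\<lambda>x. birkhoff_sum f \<alpha> r (real r * x)) \<alpha> a b \<kappa>"
    using \<sigma>(1) \<open>b > 0\<close> by (intro exI[of _ "\<sigma> / 2"] exI[of _ \<kappa>]) (auto simp: \<kappa>_def)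
qed

section \<open>The dense set of rotation angles\<close>

lemma index_at_top_of_vanishing_values:
  fixes N :: "nat \<Rightarrow> real" and q :: "nat \<Rightarrow> nat"
  assumes pos: "\<And>n. n \<ge> 1 \<Longrightarrow> 0 < N (q n)" and lim: "(\<lambda>n. N (q n)) \<longlonglongrightarrow> 0"
  shows "filterlim q at_top sequentially"
  unfolding filterlim_at_top
proof
  fix M
  define D where "D = insert 1 (N ` {m. m \<le> M \<and> N m > 0})"
  have D: "finite D" "D \<noteq> {}" by (auto simp: D_def)
  have "Min D \<in> D" using D by (rule Min_in)
  then have "Min D > 0" by (auto simp: D_def)
  then have "\<forall>\<^sub>F n in sequentially. N (q n) < Min D" by (rule order_tendstoD(2)[OF lim])
  with eventually_ge_at_top[of 1] show "\<forall>\<^sub>F n in sequentially. M \<le> q n"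
  proof eventually_elim
    case (elim n)
    show ?case
    proof (rule ccontr)
      assume "\<not> M \<le> q n"
      then have "N (q n) \<in> D" using pos[OF elim(1)] by (auto simp: D_def)
      then show False using elim(2) Min_le[OF D(1)] by fastforce
    qed
  qed
qed

lemma dense_gdelta_of_fractions:
  fixes q :: "nat \<Rightarrow> nat" and \<epsilon> :: "nat \<Rightarrow> real"
  assumes q: "filterlim q at_top sequentially" and \<epsilon>: "\<And>k. \<epsilon> k > 0"
  defines "U \<equiv> \<lambda>K. {\<alpha>. \<exists>k\<ge>K. \<exists>p::int. coprime p (int (q k)) \<and> \<bar>\<alpha> - p / q k\<bar> < \<epsilon> k}"
  shows "gdelta_in euclideanreal ((\<Inter>K. U K) - \<rat>)" and "closure ((\<Inter>K. U K) - \<rat>) = UNIV"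
proof -
  define \<G> where "\<G> = range U \<union> (\<lambda>r::real. - {r}) ` \<rat>"
  have G: "(\<Inter>K. U K) - \<rat> = \<Inter>\<G>" by (auto simp: \<G>_def)
  have op: "open (U K)" for K
  proof -
    have ball: "ball c e = {x. \<bar>x - c\<bar> < e}" for c e :: real by (auto simp: dist_real_def)
    have "U K = (\<Union>k\<in>{K..}. \<Union>p\<in>{p. coprime p (int (q k))}. ball (p / q k) (\<epsilon> k))"
      unfolding U_def ball by blast
    then show ?thesis by auto
  qed
  have dense: "closure (U K) = UNIV" for K
  proof -
    have "x \<in> closure (U K)" for x
      unfolding closure_approachable
    proof (intro allI impI)
      fix e :: real assume "e > 0"
      then obtain Q where Q: "\<And>q. q > Q \<Longrightarrow> \<exists>p::int. coprime p (int q) \<and> x < p / q \<and> p / q \<le> x + e / 2"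
        using coprime_fraction_in_interval[of x "x + e / 2"] by auto
      have "\<forall>\<^sub>F k in sequentially. Suc Q \<le> q k" using q by (simp add: filterlim_at_top)
      with eventually_ge_at_top[of K] have "\<forall>\<^sub>F k in sequentially. K \<le> k \<and> Suc Q \<le> q k"
        by eventually_elim simp
      then obtain k where k: "K \<le> k" "Q < q k" by (auto simp: eventually_sequentially)
      then obtain p :: int where p: "coprime p (int (q k))" "x < p / q k" "p / q k \<le> x + e / 2" using Q by blast
      then have "p / q k \<in> U K" using k(1) \<epsilon>[of k] by (auto simp: U_def intro!: exI[of _ k] exI[of _ p])
      then show "\<exists>y\<in>U K. dist y x < e"
        using p \<open>e > 0\<close> by (intro bexI[of _ "p / q k"]) (auto simp: dist_real_def)
    qed
    then show ?thesis by auto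
  qed
  have "closure (- {r}) = UNIV" for r :: real
    by (simp add: closure_complement)
  then have od: "open T \<and> closure T = UNIV" if "T \<in> \<G>" for T
    using that op dense by (auto simp: \<G>_def)
  have cnt: "countable \<G>" "\<G> \<noteq> {}" by (auto simp: \<G>_def countable_rat)
  show "gdelta_in euclideanreal ((\<Inter>K. U K) - \<rat>)"
    unfolding G by (rule gdelta_in_Inter[OF cnt]) (use od in \<open>auto intro: open_imp_gdelta_in\<close>)
  have "UNIV \<subseteq> closure (\<Inter>\<G>)"
    by (rule Baire) (use cnt od in auto)
  then show "closure ((\<Inter>K. U K) - \<rat>) = UNIV" unfolding G by auto
qed

theorem theorem5p6:
  fixes f :: "real \<Rightarrow> real"
  assumes periodic: "\<And>x. f (x + 1) = f x"
    and meas: "f \<in> borel_measurable lborel"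
    and L2: "integrable (lebesgue_on {0..1}) (\<lambda>x. (f x)\<^sup>2)"
    and mean0: "integral\<^sup>L (lebesgue_on {0..1}) f = 0"
    and abs_summable: "(\<lambda>n. norm (fourier_coeff f n)) summable_on (UNIV :: int set)"
    and seq: "\<exists>(q :: nat \<Rightarrow> nat) (C :: real). C > 0 \<and>
       (\<forall>n\<ge>1. real (q n) * (\<Sum>\<^sub>\<infinity>l\<in>(UNIV :: int set). norm (fourier_coeff f (l * int (q n))))
                 \<le> C * L2_norm_T (fold_sum f (q n))) \<and>
       (\<forall>n\<ge>1. 0 < L2_norm_T (fold_sum f (q n))) \<and>
       (\<lambda>n. L2_norm_T (fold_sum f (q n))) \<longlonglongrightarrow> 0"
  shows "\<exists>G :: real set. gdelta_in euclideanreal G \<and> closure G = UNIV \<and> G \<inter> \<rat> = {} \<and>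
           (\<forall>\<alpha>\<in>G. \<forall>r::nat\<ge>1. ergodic_skew \<alpha> (\<lambda>x. birkhoff_sum f \<alpha> r (real r * x)))"
proof -
  have f [measurable]: "f \<in> borel_measurable borel" using meas by simp
  define \<gamma> where "\<gamma> = fourier_series (fourier_coeff f)"
  define g where "g = (\<lambda>x. Re (\<gamma> x))"
  have g: "continuous_on UNIV g"
    unfolding g_def \<gamma>_def by (intro continuous_intros continuous_fourier_series abs_summable)
  then have [measurable]: "g \<in> borel_measurable borel" by (rule borel_measurable_continuous_onI)
  have gper: "g (x + 1) = g x" for x by (simp add: g_def \<gamma>_def fourier_series_periodic)
  have fg: "AE x in lborel. f x = g x"
    unfolding g_def \<gamma>_def
    by (rule periodic_eq_AE_fourier_series[OF f periodic integrable_of_square_integrable[OF f L2] abs_summable])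
  define N where "N = (\<lambda>m. L2_norm_T (fold_sum f m))"
  obtain q' C where "C > 0"
    and sup: "\<And>n. n \<ge> 1 \<Longrightarrow> real (q' n) * (\<Sum>\<^sub>\<infinity>l. norm (fourier_coeff f (l * int (q' n)))) \<le> C * N (q' n)"
    and pos: "\<And>n. n \<ge> 1 \<Longrightarrow> 0 < N (q' n)" and lim: "(\<lambda>n. N (q' n)) \<longlonglongrightarrow> 0"
    using seq unfolding N_def by blast
  have q'top: "filterlim q' at_top sequentially"
    by (rule index_at_top_of_vanishing_values[where N=N and q=q', OF pos lim])
  define q where "q = (\<lambda>k. q' (Suc k))"
  have qtop: "filterlim q at_top sequentially"
    unfolding q_def by (rule filterlim_compose[OF q'top filterlim_Suc])
  have Npos: "N (q k) > 0" for k by (simp add: q_def pos)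
  have Nlim: "(\<lambda>k. N (q k)) \<longlonglongrightarrow> 0" unfolding q_def using lim by (rule LIMSEQ_Suc)
  have qpos: "q k > 0" for k
  proof (rule ccontr)
    assume "\<not> q k > 0"
    then have "fold_sum f (q k) = (\<lambda>_. 0)" by (simp add: fold_sum_def fun_eq_iff)
    then show False using Npos[of k] by (simp add: N_def L2_norm_T_def)
  qed
  have bd: "\<bar>fold_sum g (q k) x\<bar> \<le> C * N (q k)" for k x
  proof -
    have "\<bar>fold_sum g (q k) x\<bar> = \<bar>Re (\<Sum>j<q k. \<gamma> (x + real j / real (q k)))\<bar>"
      by (simp add: fold_sum_def g_def)
    also have "\<dots> \<le> norm (\<Sum>j<q k. \<gamma> (x + real j / real (q k)))" by (rule abs_Re_le_cmod)
    also have "\<dots> \<le> real (q k) * (\<Sum>\<^sub>\<infinity>l. norm (fourier_coeff f (l * int (q k))))"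
      unfolding \<gamma>_def by (rule norm_fold_fourier_series_le[OF abs_summable qpos])
    also have "\<dots> \<le> C * N (q k)" unfolding q_def by (rule sup) simp
    finally show ?thesis .
  qed
  have norm: "(\<integral>x. indicator {0..1} x *\<^sub>R (fold_sum g (q k) x)\<^sup>2 \<partial>lborel) = (N (q k))\<^sup>2" for k
    unfolding N_def fold_sum_eq_birkhoff_sum
    by (rule L2_norm_T_square[symmetric]) (auto intro: birkhoff_sum_eq_AE fg)
  have "uniformly_continuous_on UNIV g" using g gper by (rule uniformly_continuous_periodic)
  then have "\<exists>\<epsilon>>0. \<forall>\<alpha> \<beta> n. \<bar>\<alpha> - \<beta>\<bar> < \<epsilon> \<longrightarrow> real n \<le> real (Suc k) * real (q k) / N (q k) \<longrightarrow>
      real n * \<bar>\<alpha> - \<beta>\<bar> \<le> 1 / real (Suc k) \<and>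
      (\<forall>x. \<bar>birkhoff_sum g \<alpha> n x - birkhoff_sum g \<beta> n x\<bar> \<le> 1 / real (Suc k))" for k
    by (rule birkhoff_sum_perturb) simp
  then obtain \<epsilon> where \<epsilon>: "\<And>k. \<epsilon> k > 0"
    "\<And>k \<alpha> \<beta> n. \<bar>\<alpha> - \<beta>\<bar> < \<epsilon> k \<Longrightarrow> real n \<le> real (Suc k) * real (q k) / N (q k) \<Longrightarrow>
      real n * \<bar>\<alpha> - \<beta>\<bar> \<le> 1 / real (Suc k) \<and>
      (\<forall>x. \<bar>birkhoff_sum g \<alpha> n x - birkhoff_sum g \<beta> n x\<bar> \<le> 1 / real (Suc k))"
    by metis
  define U where "U = (\<lambda>K. {\<alpha>. \<exists>k\<ge>K. \<exists>p::int. coprime p (int (q k)) \<and> \<bar>\<alpha> - p / q k\<bar> < \<epsilon> k})"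
  show ?thesis
  proof (intro exI[of _ "(\<Inter>K. U K) - \<rat>"] conjI ballI allI impI)
    show "gdelta_in euclideanreal ((\<Inter>K. U K) - \<rat>)" "closure ((\<Inter>K. U K) - \<rat>) = UNIV"
      unfolding U_def using dense_gdelta_of_fractions[OF qtop \<epsilon>(1)] by simp_all
    show "((\<Inter>K. U K) - \<rat>) \<inter> \<rat> = {}" by auto
    fix \<alpha> and r :: nat assume \<alpha>: "\<alpha> \<in> (\<Inter>K. U K) - \<rat>" and r: "1 \<le> r"
    then have "\<forall>K. \<exists>k p. K \<le> k \<and> coprime p (int (q k)) \<and> \<bar>\<alpha> - of_int p / q k\<bar> < \<epsilon> k"
      by (auto simp: U_def)
    then obtain \<kappa> p where \<kappa>: "\<And>K. K \<le> \<kappa> K" "\<And>K. coprime (p K) (int (q (\<kappa> K)))"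
        "\<And>K. \<bar>\<alpha> - of_int (p K) / q (\<kappa> K)\<bar> < \<epsilon> (\<kappa> K)"
      by metis
    have \<kappa>top: "filterlim \<kappa> at_top sequentially"
      by (rule filterlim_at_top_mono[OF filterlim_ident]) (use \<kappa>(1) in auto)
    show "ergodic_skew \<alpha> (\<lambda>x. birkhoff_sum f \<alpha> r (real r * x))"
    proof (rule ergodic_skew_of_approximations[where C=C and p=p and q="\<lambda>K. q (\<kappa> K)"
          and s="\<lambda>K. N (q (\<kappa> K))" and \<omega>="\<lambda>K. real (Suc (\<kappa> K))", OF f periodic g gper fg])
      show "(\<lambda>K. N (q (\<kappa> K))) \<longlonglongrightarrow> 0" by (rule filterlim_compose[OF Nlim \<kappa>top])
      show "filterlim (\<lambda>K. q (\<kappa> K)) at_top sequentially" by (rule filterlim_compose[OF qtop \<kappa>top])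
      show "filterlim (\<lambda>K. real (Suc (\<kappa> K))) at_top sequentially"
        by (rule filterlim_compose[OF filterlim_real_sequentially filterlim_compose[OF filterlim_Suc \<kappa>top]])
    qed (use \<alpha> r \<open>C > 0\<close> \<kappa> Npos qpos bd norm \<epsilon>(2)[OF \<kappa>(3)] in auto)
  qed
qed

end
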